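(* Let $n>0$ and let $x_1,\ldots,x_n\in\Sigma$ be pairwise different points. Let $\Psi\in\mathcal H=\mathcal H_{AL}\otimes\mathcal F_-$ be gauge invariant, i.e. $U_g\Psi=\Psi$ for every gauge transformation $g$. Then for all $(k_1,\ldots,k_n)\in\{1,2,3\}^n$ $$W^{k_1\ldots k_n}(x_1,\ldots,x_n):=\langle \Psi,\; S^{k_1}(x_1)\,S^{k_2}(x_2)\cdots S^{k_n}(x_n)\,\Psi\rangle = 0 .$$
   Context: $\Sigma$ is a 3-dimensional (analytic) manifold. Gravitational Hilbert space: $\mathcal H_{AL}=L^2(\overline{\mathcal A},d\mu_{AL})$ is the Ashtekar–Lewandowski Hilbert space for $SU(2)$ connections on $\Sigma$. It is the completion of the space of cylindrical functions $\psi(h_{e_1},\ldots,h_{e_m})$ of holonomies $h_e\in SU(2)$ along the edges $e$ of finite embedded graphs in $\Sigma$, where on each graph with $m$ edges the inner product is that of $L^2(SU(2)^m)$ with normalized Haar measure. An edge $e$ has source $s(e)$ and target $t(e)$. Fermionic Hilbert space: $\mathcal F_-$ is the fermionic (antisymmetric) Fock space over the one-particle space $\ell^2(\Sigma,\mathbb C^2)$, the completion of the finitely supported functions $f:\Sigma\to\mathbb C^2$ with $\langle f,f'\rangle=\sum_{x\in\Sigma}\overline{f(x)}\cdot f'(x)$. Annihilation operators $\theta_A(x)$ and their adjoints, the creation operators $\theta_A^\dagger(x)$ ($x\in\Sigma$, $A\in\{1,2\}$), satisfy $\theta_A(x)\theta_B^\dagger(y)+\theta_B^\dagger(y)\theta_A(x)=\delta_{x,y}\delta_{AB}$,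 all other anticommutators being zero, and $\theta_A(x)|0\rangle=0$. The total Hilbert space is $\mathcal H=\mathcal H_{AL}\otimes\mathcal F_-$. Gauge transformations: these are arbitrary maps $g:\Sigma\to SU(2)$. They act on $\mathcal H$ by unitaries $U_g$, tensor products of unitaries on the two factors. On $\mathcal H_{AL}$, $U_g$ is induced by $h_e\mapsto g(t(e))\,h_e\,g(s(e))^{-1}$. On $\mathcal F_-$, $U_g|0\rangle=|0\rangle$ and $U_g\theta_A(x)U_g^{-1}=\sum_B g(x)_{AB}\,\theta_B(x)$. Spin operators: with the Pauli matrices $\sigma^1,\sigma^2,\sigma^3$, $$S^i(x)=\tfrac12\sum_{A,B}\theta_A^\dagger(x)\,(\sigma^i)_{AB}\,\theta_B(x),\qquad i=1,2,3,$$ acting as the identity on $\mathcal H_{AL}$. One has $U_gS^i(x)U_g^{-1}=\sum_j\pi_1(g(x))^i{}_j\,S^j(x)$, where $\pi_1$ is the spin-1 (adjoint, rotation) representation of $SU(2)$. *)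

theory Defs
  imports "HOL-Probability.Probability" "HOL-Combinatorics.Permutations"
begin

section \<open>Real-analytic 3-manifolds, edges and graphs\<close>

text \<open>The manifold is the whole type \<open>'s\<close>.  A chart is a pair of a domain and a coordinate map.\<close>

definition real_analytic_on :: "(real^'n \<Rightarrow> 'b::real_normed_vector) \<Rightarrow> (real^'n) set \<Rightarrow> bool" where
  "real_analytic_on f S \<longleftrightarrow>
    (\<forall>a\<in>S. \<exists>(c :: ('n \<Rightarrow> nat) \<Rightarrow> 'b) r. r > 0 \<and>
      (\<forall>y\<in>S \<inter> ball a r.
        ((\<lambda>\<alpha>. (\<Prod>i\<in>UNIV. (y$i - a$i) ^ \<alpha> i) *\<^sub>R c \<alpha>) has_sum f y) UNIV))"

type_synonym 's chart = "'s set \<times> ('s \<Rightarrow> real^3)"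

definition analytic_atlas :: "('s::{t2_space,second_countable_topology}) chart set \<Rightarrow> bool" where
  "analytic_atlas \<A> \<longleftrightarrow>
    (\<Union>(U, \<phi>)\<in>\<A>. U) = UNIV \<and>
    (\<forall>(U, \<phi>)\<in>\<A>. open U \<and> open (\<phi> ` U) \<and> homeomorphism U (\<phi> ` U) \<phi> (inv_into U \<phi>)) \<and>
    (\<forall>(U, \<phi>)\<in>\<A>. \<forall>(V, \<psi>)\<in>\<A>. real_analytic_on (\<psi> \<circ> inv_into U \<phi>) (\<phi> ` (U \<inter> V)))"

text \<open>Edges are oriented, analytically embedded closed intervals, given by a parametrisation over
  \<open>[0,1]\<close>; the source is \<^const>\<open>pathstart\<close>, the target \<^const>\<open>pathfinish\<close>.  Analyticity includes
  the end points (the local power series extend the curve beyond them), \<open>c 1 \<noteq> 0\<close> says that the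
  velocity does not vanish, and an injective immersion of a compact interval is an embedding.
  Closed curves are covered by subdividing them.\<close>

definition edges :: "('s::{t2_space,second_countable_topology}) chart set \<Rightarrow> (real \<Rightarrow> 's) set" where
  "edges \<A> = {e. inj_on e {0..1} \<and>
    (\<forall>t\<in>{0..1}. \<exists>(U, \<phi>)\<in>\<A>. \<exists>(c :: nat \<Rightarrow> real^3) r. r > 0 \<and> c 1 \<noteq> 0 \<and>
      (\<forall>s\<in>{0..1}. \<bar>s - t\<bar> < r \<longrightarrow> e s \<in> U \<and> (\<lambda>k. (s - t) ^ k *\<^sub>R c k) sums \<phi> (e s)))}"

definition graphs :: "('s::{t2_space,second_countable_topology}) chart set \<Rightarrow> (real \<Rightarrow> 's) set set" where
  "graphs \<A> = {\<gamma>. finite \<gamma> \<and> \<gamma> \<subseteq> edges \<A> \<and>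
    (\<forall>e\<in>\<gamma>. \<forall>e'\<in>\<gamma>. e \<noteq> e' \<longrightarrow>
      path_image e \<inter> path_image e' \<subseteq> {pathstart e, pathfinish e} \<inter> {pathstart e', pathfinish e'})}"

section \<open>\<open>SU(2)\<close> and its Haar measure\<close>

definition adj :: "complex^2^2 \<Rightarrow> complex^2^2" where
  "adj M = (\<chi> i j. cnj (M $ j $ i))"

definition SU2 :: "(complex^2^2) set" where
  "SU2 = {M. M ** adj M = mat 1 \<and> det M = 1}"

abbreviation SU2_borel :: "(complex^2^2) measure" where
  "SU2_borel \<equiv> restrict_space borel SU2"

definition haar_SU2 :: "(complex^2^2) measure \<Rightarrow> bool" where
  "haar_SU2 \<nu> \<longleftrightarrow> prob_space \<nu> \<and> sets \<nu> = sets SU2_borel \<and>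
    (\<forall>h\<in>SU2. distr \<nu> \<nu> (\<lambda>u. h ** u) = \<nu>)"

section \<open>Generalised connections and the Ashtekar--Lewandowski measure\<close>

text \<open>A generalised connection assigns to every edge a holonomy in \<open>SU(2)\<close>, depending only on the
  oriented image of the edge, such that reversal goes to the inverse and composition to the product.
  The order of the product is the one compatible with \<open>h\<^sub>e \<mapsto> g(t(e)) h\<^sub>e g(s(e))\<^sup>-\<^sup>1\<close>.
  Outside the set of edges the function has the conventional value \<^term>\<open>undefined\<close>.\<close>

type_synonym 's connection = "(real \<Rightarrow> 's) \<Rightarrow> complex^2^2"

definition edge_part :: "real \<Rightarrow> real \<Rightarrow> (real \<Rightarrow> 's) \<Rightarrow> (real \<Rightarrow> 's)" where
  "edge_part a b e = (\<lambda>t. e (a + (b - a) * t))"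

definition connections :: "('s::{t2_space,second_countable_topology}) chart set \<Rightarrow> 's connection set" where
  "connections \<A> = {A \<in> edges \<A> \<rightarrow>\<^sub>E SU2.
    (\<forall>e\<in>edges \<A>. \<forall>e'\<in>edges \<A>.
      path_image e = path_image e' \<and> pathstart e = pathstart e' \<longrightarrow> A e = A e') \<and>
    (\<forall>e\<in>edges \<A>. A (reversepath e) = matrix_inv (A e)) \<and>
    (\<forall>e\<in>edges \<A>. \<forall>c\<in>{0<..<1}. A e = A (edge_part c 1 e) ** A (edge_part 0 c e))}"

text \<open>The sigma-algebra is the one generated by the holonomies.  It yields the same \<open>L\<^sup>2\<close> space as the
  Borel sigma-algebra, since the cylindrical functions are dense in both.\<close>

definition connection_space ::
    "('s::{t2_space,second_countable_topology}) chart set \<Rightarrow> 's connection measure" where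
  "connection_space \<A> = restrict_space (Pi\<^sub>M (edges \<A>) (\<lambda>_. SU2_borel)) (connections \<A>)"

text \<open>The holonomies along the edges of any graph are independent and Haar distributed, i.e. on
  cylindrical functions over a graph with \<open>m\<close> edges the \<open>L\<^sup>2\<close> inner product is that of
  \<open>L\<^sup>2(SU(2)\<^sup>m)\<close>.\<close>

definition graphwise_haar :: "(complex^2^2) measure \<Rightarrow>
    ('s::{t2_space,second_countable_topology}) chart set \<Rightarrow> 's connection measure \<Rightarrow> bool" where
  "graphwise_haar \<nu> \<A> \<mu> \<longleftrightarrow> sets \<mu> = sets (connection_space \<A>) \<and>
    (\<forall>\<gamma>\<in>graphs \<A>. distr \<mu> (Pi\<^sub>M \<gamma> (\<lambda>_. \<nu>)) (\<lambda>A. restrict A \<gamma>) = Pi\<^sub>M \<gamma> (\<lambda>_. \<nu>))"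

text \<open>The Ashtekar--Lewandowski measure is the unique such measure.  That there is exactly one is
  a theorem of Ashtekar and Lewandowski; uniqueness rests on the fact that finitely many analytic
  edges can always be decomposed into the edges of one graph.\<close>

definition AL_measure :: "(complex^2^2) measure \<Rightarrow>
    ('s::{t2_space,second_countable_topology}) chart set \<Rightarrow> 's connection measure \<Rightarrow> bool" where
  "AL_measure \<nu> \<A> \<mu> \<longleftrightarrow> graphwise_haar \<nu> \<A> \<mu> \<and>
    (\<forall>\<mu>'. graphwise_haar \<nu> \<A> \<mu>' \<longrightarrow> \<mu>' = \<mu>)"

text \<open>Elements of \<open>L\<^sup>2(\<mu>)\<close> are represented by square-integrable functions.\<close>

definition L2 :: "'a measure \<Rightarrow> ('a \<Rightarrow> complex) set" where
  "L2 \<mu> = {\<psi>. \<psi> \<in> borel_measurable \<mu> \<and> integrable \<mu> (\<lambda>A. (norm (\<psi> A))\<^sup>2)}"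

definition L2_inner :: "'a measure \<Rightarrow> ('a \<Rightarrow> complex) \<Rightarrow> ('a \<Rightarrow> complex) \<Rightarrow> complex" where
  "L2_inner \<mu> \<psi> \<psi>' = (LINT A|\<mu>. cnj (\<psi> A) * \<psi>' A)"

section \<open>Fermionic Fock space\<close>

text \<open>The one-particle space \<open>\<ell>\<^sup>2(\<Sigma>, \<complex>\<^sup>2)\<close> has the orthonormal basis indexed by the modes
  \<open>(x, A)\<close>, so its \<open>n\<close>-th tensor power is the \<open>\<ell>\<^sup>2\<close> space over lists of \<open>n\<close> modes, and
  Fock space consists of the antisymmetric square-summable wave functions on lists of all lengths.\<close>

type_synonym 's mode = "'s \<times> 2"

definition antisymmetric :: "('p list \<Rightarrow> complex) \<Rightarrow> bool" where
  "antisymmetric \<phi> \<longleftrightarrow>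
    (\<forall>l p. p permutes {..<length l} \<longrightarrow> \<phi> (permute_list p l) = of_int (sign p) * \<phi> l)"

definition fock :: "('p list \<Rightarrow> complex) set" where
  "fock = {\<phi>. antisymmetric \<phi> \<and> (\<lambda>l. (norm (\<phi> l))\<^sup>2) summable_on UNIV}"

definition fock_inner :: "('p list \<Rightarrow> complex) \<Rightarrow> ('p list \<Rightarrow> complex) \<Rightarrow> complex" where
  "fock_inner \<phi> \<phi>' = (\<Sum>\<^sub>\<infinity>l. cnj (\<phi> l) * \<phi>' l)"

definition fock_vacuum :: "'p list \<Rightarrow> complex" where
  "fock_vacuum l = (if l = [] then 1 else 0)"

text \<open>\<open>annih x A\<close> is \<open>\<theta>\<^sub>A(x)\<close> and \<open>create x A\<close> is \<open>\<theta>\<^sub>A\<^sup>\<dagger>(x)\<close>, the latter being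
  \<open>\<surd>n\<close> times the antisymmetrisation of \<open>e\<^bsub>(x,A)\<^esub> \<otimes> \<phi>\<close> in the sector of \<open>n\<close> particles.\<close>

definition annih :: "'s \<Rightarrow> 2 \<Rightarrow> ('s mode list \<Rightarrow> complex) \<Rightarrow> 's mode list \<Rightarrow> complex" where
  "annih x A \<phi> l = of_real (sqrt (length l + 1)) * \<phi> ((x, A) # l)"

definition create :: "'s \<Rightarrow> 2 \<Rightarrow> ('s mode list \<Rightarrow> complex) \<Rightarrow> 's mode list \<Rightarrow> complex" where
  "create x A \<phi> l =
    (\<Sum>j<length l. (- 1) ^ j * (if l ! j = (x, A) then \<phi> (take j l @ drop (Suc j) l) else 0))
      / of_real (sqrt (length l))"

definition pauli :: "3 \<Rightarrow> complex^2^2" where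
  "pauli k = (if k = 1 then vector [vector [0, 1], vector [1, 0]]
    else if k = 2 then vector [vector [0, - \<i>], vector [\<i>, 0]]
    else vector [vector [1, 0], vector [0, - 1]])"

definition fock_spin :: "3 \<Rightarrow> 's \<Rightarrow> ('s mode list \<Rightarrow> complex) \<Rightarrow> 's mode list \<Rightarrow> complex" where
  "fock_spin k x \<phi> l =
    1/2 * (\<Sum>A\<in>UNIV. \<Sum>B\<in>UNIV. pauli k $ A $ B * create x A (annih x B \<phi>) l)"

text \<open>The implementation of a gauge transformation on Fock space acts on every tensor factor by the
  one-particle unitary \<open>(u f)(x)\<^sub>B = (\<Sum>A. cnj (g(x)\<^sub>A\<^sub>B) f(x)\<^sub>A)\<close>.  The complex conjugate is what
  \<open>U\<^sub>g \<theta>\<^sub>A(x) U\<^sub>g\<^sup>-\<^sup>1 = (\<Sum>B. g(x)\<^sub>A\<^sub>B \<theta>\<^sub>B(x))\<close> requires, see \<open>fock_gauge_annih\<close> below.\<close>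

fun fock_gauge ::
    "('s \<Rightarrow> complex^2^2) \<Rightarrow> ('s mode list \<Rightarrow> complex) \<Rightarrow> 's mode list \<Rightarrow> complex" where
  "fock_gauge g \<phi> [] = \<phi> []"
| "fock_gauge g \<phi> ((x, B) # l) =
    (\<Sum>A\<in>UNIV. cnj (g x $ A $ B) * fock_gauge g (\<lambda>m. \<phi> ((x, A) # m)) l)"

section \<open>The total Hilbert space\<close>

text \<open>The tensor product \<open>L\<^sup>2(\<mu>) \<otimes> F\<close> is realised inside the Hilbert space of all square-summable
  families of elements of \<open>L\<^sup>2(\<mu>)\<close> indexed by lists of modes: there
  \<open>\<langle>\<psi> \<otimes> \<phi>, \<psi>' \<otimes> \<phi>'\<rangle> = \<langle>\<psi>, \<psi>'\<rangle> \<langle>\<phi>, \<phi>'\<rangle>\<close> (\<open>total_inner_tensor\<close> below), so the closure of the span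
  of the pure tensors is the completion of the algebraic tensor product.\<close>

definition total_inner ::
    "'a measure \<Rightarrow> ('p list \<Rightarrow> 'a \<Rightarrow> complex) \<Rightarrow> ('p list \<Rightarrow> 'a \<Rightarrow> complex) \<Rightarrow> complex" where
  "total_inner \<mu> \<Phi> \<Psi> = (\<Sum>\<^sub>\<infinity>l. L2_inner \<mu> (\<Phi> l) (\<Psi> l))"

definition tensor :: "('a \<Rightarrow> complex) \<Rightarrow> ('p list \<Rightarrow> complex) \<Rightarrow> 'p list \<Rightarrow> 'a \<Rightarrow> complex" where
  "tensor \<psi> \<phi> l A = \<psi> A * \<phi> l"

definition families :: "'a measure \<Rightarrow> ('p list \<Rightarrow> 'a \<Rightarrow> complex) set" where
  "families \<mu> = {\<Psi>. (\<forall>l. \<Psi> l \<in> L2 \<mu>) \<and> (\<lambda>l. L2_inner \<mu> (\<Psi> l) (\<Psi> l)) summable_on UNIV}"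

definition total_space :: "'a measure \<Rightarrow> ('p list \<Rightarrow> 'a \<Rightarrow> complex) set" where
  "total_space \<mu> = {\<Psi> \<in> families \<mu>. \<forall>\<epsilon>>0. \<exists>(m::nat) \<psi> \<phi>.
    (\<forall>i<m. \<psi> i \<in> L2 \<mu> \<and> \<phi> i \<in> fock) \<and>
    (let \<Delta> = (\<lambda>l A. \<Psi> l A - (\<Sum>i<m. tensor (\<psi> i) (\<phi> i) l A))
     in norm (total_inner \<mu> \<Delta> \<Delta>) < \<epsilon>)}"

text \<open>Equality of the vectors represented by two families.\<close>

definition total_eq ::
    "'a measure \<Rightarrow> ('p list \<Rightarrow> 'a \<Rightarrow> complex) \<Rightarrow> ('p list \<Rightarrow> 'a \<Rightarrow> complex) \<Rightarrow> bool" where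
  "total_eq \<mu> \<Phi> \<Psi> \<longleftrightarrow> (\<forall>l. AE A in \<mu>. \<Phi> l A = \<Psi> l A)"

text \<open>\<open>fock_lift T\<close> is \<open>1 \<otimes> T\<close>.\<close>

definition fock_lift :: "(('p list \<Rightarrow> complex) \<Rightarrow> 'p list \<Rightarrow> complex) \<Rightarrow>
    ('p list \<Rightarrow> 'a \<Rightarrow> complex) \<Rightarrow> 'p list \<Rightarrow> 'a \<Rightarrow> complex" where
  "fock_lift T \<Psi> l A = T (\<lambda>m. \<Psi> m A) l"

definition spin :: "3 \<Rightarrow> 's \<Rightarrow> ('s mode list \<Rightarrow> 'a \<Rightarrow> complex) \<Rightarrow> 's mode list \<Rightarrow> 'a \<Rightarrow> complex" where
  "spin k x = fock_lift (fock_spin k x)"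

definition gauge_transformation :: "('s \<Rightarrow> complex^2^2) \<Rightarrow> bool" where
  "gauge_transformation g \<longleftrightarrow> (\<forall>x. g x \<in> SU2)"

definition connection_gauge :: "('s::{t2_space,second_countable_topology}) chart set \<Rightarrow>
    ('s \<Rightarrow> complex^2^2) \<Rightarrow> 's connection \<Rightarrow> 's connection" where
  "connection_gauge \<A> g A =
    (\<lambda>e\<in>edges \<A>. g (pathfinish e) ** A e ** matrix_inv (g (pathstart e)))"

definition AL_gauge :: "('s::{t2_space,second_countable_topology}) chart set \<Rightarrow>
    ('s \<Rightarrow> complex^2^2) \<Rightarrow> ('s connection \<Rightarrow> complex) \<Rightarrow> 's connection \<Rightarrow> complex" where
  "AL_gauge \<A> g \<psi> A = \<psi> (connection_gauge \<A> g A)"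

definition total_gauge :: "('s::{t2_space,second_countable_topology}) chart set \<Rightarrow>
    ('s \<Rightarrow> complex^2^2) \<Rightarrow> ('s mode list \<Rightarrow> 's connection \<Rightarrow> complex) \<Rightarrow>
    's mode list \<Rightarrow> 's connection \<Rightarrow> complex" where
  "total_gauge \<A> g \<Psi> = fock_lift (fock_gauge g) (\<lambda>l. AL_gauge \<A> g (\<Psi> l))"

definition gauge_invariant :: "('s::{t2_space,second_countable_topology}) chart set \<Rightarrow>
    's connection measure \<Rightarrow> ('s mode list \<Rightarrow> 's connection \<Rightarrow> complex) \<Rightarrow> bool" where
  "gauge_invariant \<A> \<mu> \<Psi> \<longleftrightarrow>
    (\<forall>g. gauge_transformation g \<longrightarrow> total_eq \<mu> (total_gauge \<A> g \<Psi>) \<Psi>)"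

text \<open>The operator product \<open>S\<^sup>k\<^sup>1(x\<^sub>1) \<cdots> S\<^sup>k\<^sup>n(x\<^sub>n)\<close> and its expectation value.
  The spin operators are bounded on \<^const>\<open>total_space\<close>, so for \<open>\<Psi>\<close> in that space the integrals and
  the sum in the inner product converge.\<close>

definition spin_product :: "nat \<Rightarrow> (nat \<Rightarrow> 3) \<Rightarrow> (nat \<Rightarrow> 's) \<Rightarrow>
    ('s mode list \<Rightarrow> 'a \<Rightarrow> complex) \<Rightarrow> 's mode list \<Rightarrow> 'a \<Rightarrow> complex" where
  "spin_product n k x = foldr (\<lambda>i. spin (k i) (x i)) [1..<Suc n]"

definition spin_correlation :: "'a measure \<Rightarrow> ('s mode list \<Rightarrow> 'a \<Rightarrow> complex) \<Rightarrow>
    nat \<Rightarrow> (nat \<Rightarrow> 3) \<Rightarrow> (nat \<Rightarrow> 's) \<Rightarrow> complex" where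
  "spin_correlation \<mu> \<Psi> n k x = total_inner \<mu> \<Psi> (spin_product n k x \<Psi>)"

section \<open>Consistency of the definitions\<close>

lemma annih_vacuum: "annih x A fock_vacuum = (\<lambda>_. 0)"
  by (simp add: annih_def fock_vacuum_def fun_eq_iff)

lemma annih_create:
  "annih x A (create y B \<phi>) l + create y B (annih x A \<phi>) l = (if (x, A) = (y, B) then \<phi> l else 0)"
proof (cases "l = []")
  case True
  then show ?thesis by (auto simp: annih_def create_def)
next
  case False
  let ?s = "\<lambda>j. (- 1) ^ j * (if l ! j = (y, B) then \<phi> ((x, A) # take j l @ drop (Suc j) l) else 0)"
  have "annih x A (create y B \<phi>) l = (\<Sum>j<Suc (length l). (- 1) ^ j *
      (if ((x, A) # l) ! j = (y, B)
       then \<phi> (take j ((x, A) # l) @ drop (Suc j) ((x, A) # l)) else 0))"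
    unfolding annih_def create_def length_Cons Suc_eq_plus1[symmetric]
    by (simp del: sum.lessThan_Suc of_nat_Suc)
  also have "\<dots> = (if (x, A) = (y, B) then \<phi> l else 0) - (\<Sum>j<length l. ?s j)"
    unfolding sum.lessThan_Suc_shift by (simp add: sum_negf cong: if_cong)
  finally have 1: "annih x A (create y B \<phi>) l
      = (if (x, A) = (y, B) then \<phi> l else 0) - (\<Sum>j<length l. ?s j)" .
  have "create y B (annih x A \<phi>) l
      = (\<Sum>j<length l. of_real (sqrt (length l)) * ?s j) / of_real (sqrt (length l))"
    unfolding create_def annih_def
    by (rule arg_cong2[where f="(/)"], rule sum.cong) (auto simp: min_def)
  also have "\<dots> = (\<Sum>j<length l. ?s j)"
    using False by (simp add: sum_distrib_left[symmetric])
  finally show ?thesis using 1 by simp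
qed

lemma fock_gauge_sum:
  "fock_gauge g (\<lambda>m. \<Sum>i\<in>I. a i * \<phi> i m) l = (\<Sum>i\<in>I. a i * fock_gauge g (\<phi> i) l)"
proof (induction l arbitrary: \<phi>)
  case (Cons p l)
  obtain x B where p: "p = (x, B)" by force
  show ?case
    unfolding p fock_gauge.simps Cons.IH sum_distrib_left
    by (subst sum.swap) (simp add: mult.left_commute)
qed simp

lemma fock_gauge_scale: "fock_gauge g (\<lambda>m. a * \<phi> m) l = a * fock_gauge g \<phi> l"
  using fock_gauge_sum[where I="{()}" and a="\<lambda>_. a" and \<phi>="\<lambda>_. \<phi>"] by simp

lemma fock_gauge_vacuum: "fock_gauge g fock_vacuum = fock_vacuum"
proof
  fix l :: "'a mode list"
  show "fock_gauge g fock_vacuum l = fock_vacuum l"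
  proof (cases l)
    case (Cons p l')
    obtain x B where p: "p = (x, B)" by force
    have "fock_gauge g (\<lambda>m. fock_vacuum ((x, A) # m)) l' = 0" for A
      using fock_gauge_scale[of g 0 "\<lambda>_. 0" l'] by (simp add: fock_vacuum_def)
    then show ?thesis by (simp add: Cons p fock_vacuum_def)
  qed (simp add: fock_vacuum_def)
qed

lemma fock_gauge_annih:
  assumes "g x \<in> SU2"
  shows "fock_gauge g (annih x A \<phi>) l = (\<Sum>B\<in>UNIV. g x $ A $ B * annih x B (fock_gauge g \<phi>) l)"
proof -
  have orth: "(\<Sum>B\<in>UNIV. g x $ A $ B * cnj (g x $ C $ B)) = (if C = A then 1 else 0)" for C
  proof -
    have "(g x ** adj (g x)) $ A $ C = mat 1 $ A $ C"
      using assms by (simp add: SU2_def)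
    then show ?thesis
      by (simp add: matrix_matrix_mult_def adj_def mat_def eq_commute)
  qed
  have len: "fock_gauge g (\<lambda>m. f (length m) * \<eta> m) l = f (length l) * fock_gauge g \<eta> l" for f \<eta>
  proof (induction l arbitrary: f \<eta>)
    case (Cons p l)
    obtain y B where p: "p = (y, B)" by force
    show ?case
      using Cons.IH[of "\<lambda>n. f (Suc n)"] by (simp add: p sum_distrib_left mult.left_commute)
  qed simp
  let ?G = "\<lambda>C. fock_gauge g (\<lambda>m. \<phi> ((x, C) # m)) l"
  have "(\<Sum>B\<in>UNIV. g x $ A $ B * annih x B (fock_gauge g \<phi>) l)
      = of_real (sqrt (length l + 1)) * (\<Sum>C\<in>UNIV. (\<Sum>B\<in>UNIV. g x $ A $ B * cnj (g x $ C $ B)) * ?G C)"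
    unfolding annih_def fock_gauge.simps sum_distrib_left sum_distrib_right
    by (subst sum.swap) (simp add: mult_ac)
  also have "\<dots> = of_real (sqrt (length l + 1)) * ?G A"
    by (simp add: orth if_distrib[of "\<lambda>u. u * _"] cong: if_cong)
  also have "\<dots> = fock_gauge g (annih x A \<phi>) l"
    unfolding annih_def by (rule len[of "\<lambda>n. of_real (sqrt (real (n + 1)))", symmetric])
  finally show ?thesis by simp
qed

lemma total_inner_tensor:
  "total_inner \<mu> (tensor \<psi> \<phi>) (tensor \<psi>' \<phi>') = L2_inner \<mu> \<psi> \<psi>' * fock_inner \<phi> \<phi>'"
proof -
  have "L2_inner \<mu> (tensor \<psi> \<phi> l) (tensor \<psi>' \<phi>' l) = L2_inner \<mu> \<psi> \<psi>' * (cnj (\<phi> l) * \<phi>' l)" for l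
    unfolding L2_inner_def tensor_def
    by (subst integral_mult_left_zero[symmetric]) (simp add: mult_ac)
  then show ?thesis
    by (simp add: total_inner_def fock_inner_def infsum_cmult_right')
qed

lemma total_gauge_tensor:
  "total_gauge \<A> g (tensor \<psi> \<phi>) = tensor (AL_gauge \<A> g \<psi>) (fock_gauge g \<phi>)"
  by (simp add: fun_eq_iff total_gauge_def fock_lift_def AL_gauge_def tensor_def fock_gauge_scale)

lemma spin_tensor: "spin k x (tensor \<psi> \<phi>) = tensor \<psi> (fock_spin k x \<phi>)"
proof (intro ext)
  fix l A
  have "create x B (\<lambda>l. \<eta> l * c) l = create x B \<eta> l * c" for B c and \<eta> :: "'a mode list \<Rightarrow> complex"
    unfolding create_def times_divide_eq_left sum_distrib_right
    by (rule arg_cong2[where f="(/)"], rule sum.cong) auto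
  moreover have "annih x B (\<lambda>l. \<eta> l * c) = (\<lambda>l. annih x B \<eta> l * c)"
    for B c and \<eta> :: "'a mode list \<Rightarrow> complex"
    by (simp add: annih_def fun_eq_iff)
  ultimately show "spin k x (tensor \<psi> \<phi>) l A = tensor \<psi> (fock_spin k x \<phi>) l A"
    by (simp add: spin_def fock_lift_def tensor_def fock_spin_def sum_distrib_left
        mult.commute[of "\<psi> A"] mult.assoc)
qed

end

theory Submission
  imports Defs
begin

text \<open>Let \<open>g\<close> be the gauge transformation which at \<open>x\<^sub>1\<close> is a rotation by \<open>\<pi>\<close> about an axis orthogonal
  to the \<open>k\<^sub>1\<close>-th one and which is trivial at all other points.  Conjugation with \<open>U\<^sub>g\<close> turns
  \<open>S\<^sup>k\<^sup>1(x\<^sub>1)\<close> into its negative and fixes \<open>S\<^sup>k\<^sup>i(x\<^sub>i)\<close> for \<open>i > 1\<close>.  Since \<open>U\<^sub>g\<close> is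
  isometric and fixes \<open>\<Psi>\<close>, the correlation equals its own negative.

  \<open>U\<^sub>g\<close> changes the spin labels of a list of modes, but not the sites, so the argument
  applies separately to the finitely many lists over a given list of sites.
  Isometry on the factor of connections follows from the uniqueness of the Ashtekar--Lewandowski
  measure: its image under \<open>g\<close> is again Haar distributed on every graph, because the
  Haar measure of a compact group is invariant from both sides.\<close>

section \<open>Spin operators and gauge transformations on Fock space\<close>

lemma mat_1_SU2: "mat 1 \<in> SU2"
  by (simp add: SU2_def adj_def mat_def matrix_matrix_mult_def vec_eq_iff forall_2 sum_2 det_2)

lemma SU2_orthonormal:
  assumes "M \<in> SU2"
  shows "(\<Sum>B\<in>UNIV. M $ A $ B * cnj (M $ C $ B)) = (if A = C then 1 else 0)"
proof -
  have "(M ** adj M) $ A $ C = mat 1 $ A $ C"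
    using assms by (simp add: SU2_def)
  then show ?thesis
    by (simp add: matrix_matrix_mult_def adj_def mat_def)
qed

lemma fock_gauge_diff:
  "fock_gauge g (\<lambda>m. \<phi> m - \<phi>' m) l = fock_gauge g \<phi> l - fock_gauge g \<phi>' l"
proof (induction l arbitrary: \<phi> \<phi>')
  case (Cons p l)
  then show ?case
    by (cases p) (simp add: sum_subtractf right_diff_distrib)
qed simp

text \<open>Gauge transformations preserve the particle number, so the square roots that normalise
  creation and annihilation operators can be pulled through them.\<close>

lemma fock_gauge_length:
  "fock_gauge g (\<lambda>m. f (length m) * \<phi> m) l = f (length l) * fock_gauge g \<phi> l"
proof (induction l arbitrary: f \<phi>)
  case (Cons p l)
  show ?case
    using Cons.IH[of "\<lambda>n. f (Suc n)"]
    by (cases p) (simp add: sum_distrib_left mult.left_commute)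
qed simp

text \<open>The creation operator without its normalisation has a recursion along the list of modes,
  which makes it accessible to induction.\<close>

fun insertion :: "'p \<Rightarrow> ('p list \<Rightarrow> complex) \<Rightarrow> 'p list \<Rightarrow> complex" where
  "insertion p \<phi> [] = 0"
| "insertion p \<phi> (q # l) = (if q = p then \<phi> l else 0) - insertion p (\<lambda>m. \<phi> (q # m)) l"

text \<open>The head of the list contributes the term with \<open>j = 0\<close>; all later positions
  move up by one, which accounts for the alternating sign.\<close>

lemma insertion_eq_sum:
  "insertion p \<phi> l =
    (\<Sum>j<length l. (- 1) ^ j * (if l ! j = p then \<phi> (take j l @ drop (Suc j) l) else 0))"
proof (induction l arbitrary: \<phi>)
  case (Cons q l)
  show ?case
    unfolding length_Cons sum.lessThan_Suc_shift insertion.simps Cons.IH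
    by (simp add: sum_negf cong: if_cong)
qed simp

lemma create_eq_insertion:
  "create x A \<phi> = (\<lambda>l. (1 / of_real (sqrt (length l))) * insertion (x, A) \<phi> l)"
  by (simp add: fun_eq_iff create_def insertion_eq_sum)

lemma insertion_sum:
  "insertion p (\<lambda>m. \<Sum>i\<in>I. a i * \<phi> i m) l = (\<Sum>i\<in>I. a i * insertion p (\<phi> i) l)"
proof (induction l arbitrary: \<phi>)
  case (Cons q l)
  then show ?case by (simp add: sum_subtractf right_diff_distrib)
qed simp

lemma create_sum:
  "create x A (\<lambda>m. \<Sum>i\<in>I. a i * \<phi> i m) l = (\<Sum>i\<in>I. a i * create x A (\<phi> i) l)"
  by (simp add: create_eq_insertion insertion_sum sum_divide_distrib)

text \<open>The transformation acts on each tensor factor separately, so it turns the inserted basis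
  vector at \<open>(x, A)\<close> into its image, whose component at \<open>(x, D)\<close> is
  \<open>cnj (g x $ A $ D)\<close>.\<close>

lemma fock_gauge_insertion:
  "fock_gauge g (insertion (x, A) \<phi>) l
    = (\<Sum>D\<in>UNIV. cnj (g x $ A $ D) * insertion (x, D) (fock_gauge g \<phi>) l)"
proof (induction l arbitrary: \<phi>)
  case (Cons p l)
  obtain y B where p: "p = (y, B)" by force
  let ?c = "\<lambda>C. cnj (g y $ C $ B)"
  have "fock_gauge g (insertion (x, A) \<phi>) ((y, B) # l)
      = (\<Sum>C\<in>UNIV. ?c C * (fock_gauge g (\<lambda>m. if (y, C) = (x, A) then \<phi> m else 0) l
          - fock_gauge g (insertion (x, A) (\<lambda>m. \<phi> ((y, C) # m))) l))"
    by (simp add: fock_gauge_diff)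
  also have "\<dots> = (\<Sum>C\<in>UNIV. ?c C * fock_gauge g (\<lambda>m. if (y, C) = (x, A) then \<phi> m else 0) l)
      - (\<Sum>C\<in>UNIV. ?c C * (\<Sum>D\<in>UNIV. cnj (g x $ A $ D) *
          insertion (x, D) (fock_gauge g (\<lambda>m. \<phi> ((y, C) # m))) l))"
    by (simp add: Cons.IH right_diff_distrib sum_subtractf)
  also have "(\<Sum>C\<in>UNIV. ?c C * fock_gauge g (\<lambda>m. if (y, C) = (x, A) then \<phi> m else 0) l)
      = (\<Sum>D\<in>UNIV. cnj (g x $ A $ D) * (if (y, B) = (x, D) then fock_gauge g \<phi> l else 0))"
  proof -
    have "fock_gauge g (\<lambda>m. if (y, C) = (x, A) then \<phi> m else 0) l
        = (if (y, C) = (x, A) then fock_gauge g \<phi> l else 0)" for C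
      \<comment> \<open>The factor \<open>0\<close> yields the value on the zero function, which is
        the negative branch.\<close>
      using fock_gauge_scale[of g 0 \<phi> l] by (cases "(y, C) = (x, A)") auto
    \<comment> \<open>For \<open>y = x\<close> the left sum retains \<open>C = A\<close> and the
      right one \<open>D = B\<close>, both with coefficient \<open>cnj (g x $ A $ B)\<close>; for
      other \<open>y\<close> both sides vanish.\<close>
    then show ?thesis
      by (cases "y = x") (simp_all add: if_distrib[of "\<lambda>u. _ * u"] cong: if_cong)
  qed
  also have "(\<Sum>C\<in>UNIV. ?c C * (\<Sum>D\<in>UNIV. cnj (g x $ A $ D) *
          insertion (x, D) (fock_gauge g (\<lambda>m. \<phi> ((y, C) # m))) l))
      = (\<Sum>D\<in>UNIV. cnj (g x $ A $ D) *
          insertion (x, D) (\<lambda>m. \<Sum>C\<in>UNIV. ?c C * fock_gauge g (\<lambda>m. \<phi> ((y, C) # m)) m) l)"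
    unfolding insertion_sum sum_distrib_left
    by (subst sum.swap) (simp add: mult.left_commute)
  finally show ?case
    by (simp add: p right_diff_distrib sum_subtractf)
qed simp

lemma fock_gauge_create:
  "fock_gauge g (create x A \<phi>) l
    = (\<Sum>D\<in>UNIV. cnj (g x $ A $ D) * create x D (fock_gauge g \<phi>) l)"
  unfolding create_eq_insertion
  by (subst fock_gauge_length[of g "\<lambda>n. 1 / of_real (sqrt n)"])
    (simp add: fock_gauge_insertion sum_divide_distrib)

text \<open>The creation operator supplies the conjugated entry of \<open>g x\<close> and the
  annihilation operator the plain one; together they conjugate the Pauli matrix. The condition
  \<open>eigen\<close> says that the rotation belonging to \<open>g x\<close> maps the
  \<open>k\<close>-th axis to \<open>c\<close> times itself; the values \<open>1\<close> and
  \<open>-1\<close> of \<open>c\<close> occur below.\<close>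

lemma fock_gauge_fock_spin:
  assumes "g x \<in> SU2"
    and eigen: "\<And>C D. (\<Sum>A\<in>UNIV. \<Sum>B\<in>UNIV. cnj (g x $ A $ C) * pauli k $ A $ B * g x $ B $ D)
      = c * pauli k $ C $ D"
  shows "fock_gauge g (fock_spin k x \<phi>) l = c * fock_spin k x (fock_gauge g \<phi>) l"
proof -
  let ?\<theta> = "\<lambda>C D. create x C (annih x D (fock_gauge g \<phi>)) l"
  have *: "fock_gauge g (create x A (annih x B \<phi>)) l
      = (\<Sum>C\<in>UNIV. \<Sum>D\<in>UNIV. cnj (g x $ A $ C) * (g x $ B $ D * ?\<theta> C D))" for A B
  proof -
    have "fock_gauge g (annih x B \<phi>) = (\<lambda>m. \<Sum>D\<in>UNIV. g x $ B $ D * annih x D (fock_gauge g \<phi>) m)"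
      using fock_gauge_annih[of g x] assms(1) by blast
    then show ?thesis
      by (simp add: fock_gauge_create create_sum sum_distrib_left)
  qed
  have "fock_gauge g (fock_spin k x \<phi>) l
      = 1/2 * (\<Sum>A\<in>UNIV. \<Sum>B\<in>UNIV. pauli k $ A $ B * fock_gauge g (create x A (annih x B \<phi>)) l)"
    unfolding fock_spin_def fock_gauge_scale
    \<comment> \<open>The outer sum has no coefficients, so it is read as a combination with
      coefficients \<open>1\<close>.\<close>
    using fock_gauge_sum[of g "\<lambda>_. 1" "\<lambda>A m. \<Sum>B\<in>UNIV. pauli k $ A $ B * create x A (annih x B \<phi>) m"]
    by (simp add: fock_gauge_sum)
  also have "\<dots> = 1/2 * (\<Sum>C\<in>UNIV. \<Sum>D\<in>UNIV. (\<Sum>A\<in>UNIV. \<Sum>B\<in>UNIV.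
      cnj (g x $ A $ C) * pauli k $ A $ B * g x $ B $ D) * ?\<theta> C D)"
    unfolding * by (simp add: sum_2 algebra_simps)
  also have "\<dots> = c * fock_spin k x (fock_gauge g \<phi>) l"
    unfolding eigen fock_spin_def by (simp add: sum_distrib_left mult_ac)
  finally show ?thesis .
qed

section \<open>Lists of modes over fixed sites, and isometry on Fock space\<close>

definition site_lists :: "'s list \<Rightarrow> 's mode list set" where
  "site_lists ys = {l. map fst l = ys}"

lemma site_lists_Nil: "site_lists [] = {[]}"
  by (auto simp: site_lists_def)

lemma site_lists_Cons:
  "site_lists (y # ys) = (\<lambda>(B, l). (y, B) # l) ` (UNIV \<times> site_lists ys)"
  by (auto simp: site_lists_def image_iff map_eq_Cons_conv)

lemma finite_site_lists: "finite (site_lists ys)"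
  by (induction ys) (simp_all add: site_lists_Nil site_lists_Cons)

text \<open>The spin label of the head is summed innermost, so that unitarity at the first site can
  be used with the tail held fixed.\<close>

lemma sum_site_lists_Cons:
  "sum f (site_lists (y # ys)) = (\<Sum>l\<in>site_lists ys. \<Sum>B\<in>UNIV. f ((y, B) # l))"
proof -
  have "sum f (site_lists (y # ys)) = (\<Sum>(B, l)\<in>UNIV \<times> site_lists ys. f ((y, B) # l))"
    unfolding site_lists_Cons
    by (subst sum.reindex) (auto simp: inj_on_def case_prod_unfold)
  then show ?thesis
    by (simp add: sum.cartesian_product[symmetric] sum.swap[of _ UNIV])
qed

text \<open>The lists over \<open>ys\<close> index a basis of a tensor power of the spin space, on
  which the transformation is a tensor product of unitaries. By induction on the sites, the
  orthonormal rows of \<open>g y\<close> dispose of the first factor.\<close>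

lemma fock_gauge_isometry:
  assumes "gauge_transformation g"
  shows "(\<Sum>l\<in>site_lists ys. cnj (fock_gauge g \<phi> l) * fock_gauge g \<phi>' l)
    = (\<Sum>l\<in>site_lists ys. cnj (\<phi> l) * \<phi>' l)"
proof (induction ys arbitrary: \<phi> \<phi>')
  case (Cons y ys)
  let ?G = "\<lambda>\<phi> A l. fock_gauge g (\<lambda>m. \<phi> ((y, A) # m)) l"
  have orth: "(\<Sum>B\<in>UNIV. g y $ A $ B * cnj (g y $ C $ B)) = (if A = C then 1 else 0)" for A C
    using assms by (intro SU2_orthonormal) (simp add: gauge_transformation_def)
  have "(\<Sum>B\<in>UNIV. cnj (fock_gauge g \<phi> ((y, B) # l)) * fock_gauge g \<phi>' ((y, B) # l))
      = (\<Sum>A\<in>UNIV. cnj (?G \<phi> A l) * ?G \<phi>' A l)" for l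
  proof -
    have "(\<Sum>B\<in>UNIV. cnj (fock_gauge g \<phi> ((y, B) # l)) * fock_gauge g \<phi>' ((y, B) # l))
      = (\<Sum>A\<in>UNIV. \<Sum>C\<in>UNIV. (\<Sum>B\<in>UNIV. g y $ A $ B * cnj (g y $ C $ B)) *
          (cnj (?G \<phi> A l) * ?G \<phi>' C l))"
      by (simp add: sum_2 algebra_simps)
    also have "\<dots> = (\<Sum>A\<in>UNIV. cnj (?G \<phi> A l) * ?G \<phi>' A l)"
      by (simp add: orth if_distrib[of "\<lambda>u. u * _"] cong: if_cong)
    finally show ?thesis .
  qed
  then have "(\<Sum>l\<in>site_lists (y # ys). cnj (fock_gauge g \<phi> l) * fock_gauge g \<phi>' l)
      = (\<Sum>A\<in>UNIV. \<Sum>l\<in>site_lists ys. cnj (?G \<phi> A l) * ?G \<phi>' A l)"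
    unfolding sum_site_lists_Cons by (subst sum.swap) (simp only:)
  also have "\<dots> = (\<Sum>l\<in>site_lists (y # ys). cnj (\<phi> l) * \<phi>' l)"
    unfolding Cons.IH sum_site_lists_Cons by (rule sum.swap)
  finally show ?case .
qed (simp add: site_lists_Nil)

text \<open>Gauge invariance gives, for each list of modes, an identity almost everywhere, and there are
  uncountably many lists.  An operator with finite rows involves only finitely many of them at a time.\<close>

definition finite_rows :: "(('p list \<Rightarrow> complex) \<Rightarrow> 'p list \<Rightarrow> complex) \<Rightarrow> bool" where
  "finite_rows T \<longleftrightarrow> (\<forall>l. \<exists>F a. finite F \<and> (\<forall>\<phi>. T \<phi> l = (\<Sum>m\<in>F. a m * \<phi> m)))"

lemma finite_rowsE:
  assumes "finite_rows T"
  obtains F a where "\<And>l. finite (F l)" "\<And>\<phi> l. T \<phi> l = (\<Sum>m\<in>F l. a l m * \<phi> m)"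
  using assms unfolding finite_rows_def by metis

lemma finite_rows_id: "finite_rows (\<lambda>\<phi> :: 'p list \<Rightarrow> complex. \<phi>)"
  unfolding finite_rows_def
proof
  fix l :: "'p list"
  show "\<exists>F a. finite F \<and> (\<forall>\<phi> :: 'p list \<Rightarrow> complex. \<phi> l = (\<Sum>m\<in>F. a m * \<phi> m))"
    by (rule exI[of _ "{l}"], rule exI[of _ "\<lambda>_ . 1"]) simp
qed

lemma finite_rows_sum:
  fixes T :: "'i \<Rightarrow> ('p list \<Rightarrow> complex) \<Rightarrow> 'p list \<Rightarrow> complex"
  assumes "\<And>i. i \<in> I \<Longrightarrow> finite_rows (T i)"
  shows "finite_rows (\<lambda>\<phi> l. \<Sum>i\<in>I. b l i * T i \<phi> l)"
proof (cases "finite I")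
  case True
  have "\<forall>i\<in>I. \<exists>F a. (\<forall>l. finite (F l)) \<and> (\<forall>\<phi> l. T i \<phi> l = (\<Sum>m\<in>F l. a l m * \<phi> m))"
    using assms by (metis finite_rowsE)
  then obtain F a where F: "\<And>i l. i \<in> I \<Longrightarrow> finite (F i l)"
    and a: "\<And>i \<phi> l. i \<in> I \<Longrightarrow> T i \<phi> l = (\<Sum>m\<in>F i l. a i l m * \<phi> m)"
    by metis
  show ?thesis
    unfolding finite_rows_def
  proof
    fix l
    let ?U = "\<Union>i\<in>I. F i l"
    let ?a = "\<lambda>m. \<Sum>i\<in>I. b l i * (if m \<in> F i l then a i l m else 0)"
    have fin: "finite ?U" using True F by blast
    have "(\<Sum>i\<in>I. b l i * T i \<phi> l) = (\<Sum>m\<in>?U. ?a m * \<phi> m)" for \<phi>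
    proof -
      have "T i \<phi> l = (\<Sum>m\<in>?U. (if m \<in> F i l then a i l m else 0) * \<phi> m)" if "i \<in> I" for i
        unfolding a[OF that] using that fin by (intro sum.mono_neutral_cong_left) auto
      then have "(\<Sum>i\<in>I. b l i * T i \<phi> l)
          = (\<Sum>i\<in>I. \<Sum>m\<in>?U. b l i * (if m \<in> F i l then a i l m else 0) * \<phi> m)"
        by (simp add: sum_distrib_left mult.assoc)
      then show ?thesis
        by (subst (asm) sum.swap) (simp only: sum_distrib_right)
    qed
    with fin show "\<exists>F a. finite F \<and> (\<forall>\<phi>. (\<Sum>i\<in>I. b l i * T i \<phi> l) = (\<Sum>m\<in>F. a m * \<phi> m))"
      by (intro exI[of _ ?U] exI[of _ ?a]) blast
  qed
next
  \<comment> \<open>A sum over an infinite index set is \<open>0\<close> by convention, so empty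
    rows suffice.\<close>
  case False
  then show ?thesis
    by (auto simp: finite_rows_def intro!: exI[of _ "{}"])
qed

lemma finite_rows_comp:
  assumes "finite_rows S" "finite_rows T"
  shows "finite_rows (\<lambda>\<phi>. S (T \<phi>))"
proof -
  obtain F a where F: "\<And>l. finite (F l)" and a: "\<And>\<phi> l. S \<phi> l = (\<Sum>m\<in>F l. a l m * \<phi> m)"
    using assms(1) by (rule finite_rowsE) blast
  show ?thesis
    unfolding finite_rows_def
  proof
    fix l
    \<comment> \<open>With \<open>l\<close> fixed, a single row of \<open>T\<close> is regarded as
      an operator all of whose rows are equal; row \<open>l\<close> of the composition is then a
      finite combination of such operators.\<close>
    have "finite_rows (\<lambda>\<phi> (_ :: 'a list). \<Sum>m\<in>F l. a l m * T \<phi> m)"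
    proof -
      have "finite_rows (\<lambda>\<phi> (_ :: 'a list). T \<phi> m)" for m
        using assms(2) by (simp add: finite_rows_def)
      then show ?thesis by (rule finite_rows_sum[of "F l" "\<lambda>m \<phi> _. T \<phi> m" "\<lambda>_. a l"])
    qed
    then show "\<exists>F a. finite F \<and> (\<forall>\<phi>. S (T \<phi>) l = (\<Sum>m\<in>F. a m * \<phi> m))"
      by (simp add: finite_rows_def a)
  qed
qed

section \<open>Finite rows of the spin operators and their products\<close>

lemma finite_rows_annih: "finite_rows (annih x A)"
  unfolding finite_rows_def annih_def
proof
  fix l :: "'a mode list"
  show "\<exists>F a. finite F \<and>
      (\<forall>\<phi>. of_real (sqrt (length l + 1)) * \<phi> ((x, A) # l) = (\<Sum>m\<in>F. a m * \<phi> m))"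
    by (rule exI[of _ "{(x, A) # l}"], rule exI[of _ "\<lambda>_. of_real (sqrt (length l + 1))"]) simp
qed

lemma finite_rows_create: "finite_rows (create x A)"
  unfolding finite_rows_def
proof
  fix l :: "'a mode list"
  let ?J = "\<lambda>\<phi>. \<Sum>j<length l. ((- 1) ^ j * (if l ! j = (x, A) then 1 else 0) / of_real (sqrt (length l)))
      * \<phi> (take j l @ drop (Suc j) l)"
  have *: "create x A \<phi> l = ?J \<phi>" for \<phi>
    unfolding create_def sum_divide_distrib by (rule sum.cong) auto
  have "finite_rows (\<lambda>\<phi> (_ :: 'a mode list). ?J \<phi>)"
  proof (rule finite_rows_sum)
    fix j
    show "finite_rows (\<lambda>\<phi> (_ :: 'a mode list). \<phi> (take j l @ drop (Suc j) l))"
      using finite_rows_id unfolding finite_rows_def by blast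
  qed
  then show "\<exists>F a. finite F \<and> (\<forall>\<phi>. create x A \<phi> l = (\<Sum>m\<in>F. a m * \<phi> m))"
    by (simp add: finite_rows_def *)
qed

lemma finite_rows_fock_spin: "finite_rows (fock_spin k x)"
proof -
  have "fock_spin k x = (\<lambda>\<phi> l. \<Sum>(A, B)\<in>UNIV \<times> UNIV.
      (1/2 * pauli k $ A $ B) * create x A (annih x B \<phi>) l)"
    by (simp add: fun_eq_iff fock_spin_def sum.cartesian_product[symmetric] sum_distrib_left mult.assoc
        del: UNIV_Times_UNIV)
  moreover have "finite_rows (\<lambda>\<phi> l. \<Sum>p\<in>UNIV \<times> UNIV.
      (1/2 * pauli k $ fst p $ snd p) * create x (fst p) (annih x (snd p) \<phi>) l)"
    by (rule finite_rows_sum) (intro finite_rows_comp[OF finite_rows_create finite_rows_annih])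
  ultimately show ?thesis
    by (simp add: case_prod_unfold)
qed

text \<open>The factors are indexed by a list rather than by a bound, so that the first one can be
  split off and induction runs over the others.\<close>

definition fock_spin_product :: "nat list \<Rightarrow> (nat \<Rightarrow> 3) \<Rightarrow> (nat \<Rightarrow> 's) \<Rightarrow>
    ('s mode list \<Rightarrow> complex) \<Rightarrow> 's mode list \<Rightarrow> complex" where
  "fock_spin_product is k x = foldr (\<lambda>i. fock_spin (k i) (x i)) is"

lemma finite_rows_fock_spin_product: "finite_rows (fock_spin_product is k x)"
  by (induction "is")
    (simp_all add: fock_spin_product_def finite_rows_id id_def comp_def
      finite_rows_comp[OF finite_rows_fock_spin])

text \<open>Spin operators are the identity on the gravitational factor, so their product can be
  evaluated at one connection at a time.\<close>

lemma spin_product_eq: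
  "spin_product n k x \<Psi> l A = fock_spin_product [1..<Suc n] k x (\<lambda>m. \<Psi> m A) l"
proof -
  have "foldr (\<lambda>i. spin (k i) (x i)) js \<Psi> l A = fock_spin_product js k x (\<lambda>m. \<Psi> m A) l" for js l
    by (induction js arbitrary: l) (simp_all add: fock_spin_product_def spin_def fock_lift_def)
  then show ?thesis by (simp add: spin_product_def)
qed

lemma fock_gauge_fock_spin_product:
  assumes "\<And>i. i \<in> set js \<Longrightarrow> g (x i) = mat 1"
  shows "fock_gauge g (fock_spin_product js k x \<phi>) l = fock_spin_product js k x (fock_gauge g \<phi>) l"
  using assms
proof (induction js arbitrary: l)
  case (Cons j js)
  have "fock_gauge g (fock_spin (k j) (x j) (fock_spin_product js k x \<phi>)) l
      = 1 * fock_spin (k j) (x j) (fock_gauge g (fock_spin_product js k x \<phi>)) l"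
  proof (rule fock_gauge_fock_spin)
    show "g (x j) \<in> SU2"
      using Cons.prems by (simp add: mat_1_SU2)
  next
    fix C D
    have "g (x j) = mat 1" using Cons.prems by simp
    then show "(\<Sum>A\<in>UNIV. \<Sum>B\<in>UNIV. cnj (g (x j) $ A $ C) * pauli (k j) $ A $ B * g (x j) $ B $ D)
        = 1 * pauli (k j) $ C $ D"
      by (simp add: mat_def if_distrib[of cnj] if_distrib[of "\<lambda>u. u * _"] if_distrib[of "\<lambda>u. _ * u"] cong: if_cong)
  qed
  moreover have "fock_gauge g (fock_spin_product js k x \<phi>) = fock_spin_product js k x (fock_gauge g \<phi>)"
    using Cons by (intro ext) simp
  ultimately show ?case
    by (simp add: fock_spin_product_def)
qed (simp add: fock_spin_product_def)

text \<open>The matrix is \<open>\<i>\<close> times a Pauli matrix other than the \<open>k\<close>-th one.\<close>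

definition flip :: "3 \<Rightarrow> complex^2^2" where
  "flip k = (if k = 2 then vector [vector [\<i>, 0], vector [0, - \<i>]]
    else vector [vector [0, 1], vector [- 1, 0]])"

lemma flip_SU2: "flip k \<in> SU2"
  by (simp add: SU2_def flip_def adj_def mat_def matrix_matrix_mult_def vec_eq_iff forall_2 sum_2 det_2)

text \<open>Distinct Pauli matrices anticommute and square to the identity, so conjugating one by
  another reverses its sign; the proof compares the entries.\<close>

lemma flip_pauli:
  "(\<Sum>A\<in>UNIV. \<Sum>B\<in>UNIV. cnj (flip k $ A $ C) * pauli k $ A $ B * flip k $ B $ D)
    = - pauli k $ C $ D"
  using exhaust_3[of k] exhaust_2[of C] exhaust_2[of D]
  by (auto simp: flip_def pauli_def sum_2)

definition flip_gauge :: "3 \<Rightarrow> 's \<Rightarrow> 's \<Rightarrow> complex^2^2" where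
  "flip_gauge k y z = (if z = y then flip k else mat 1)"

lemma gauge_transformation_flip: "gauge_transformation (flip_gauge k y)"
  by (simp add: gauge_transformation_def flip_gauge_def flip_SU2 mat_1_SU2)

text \<open>The leftmost factor sits at the flipped site and yields the sign. Injectivity keeps the
  sites of the other factors away from \<open>x 1\<close>, so the transformation is trivial
  there.\<close>

lemma flip_gauge_fock_spin_product:
  assumes "n > 0" "inj_on x {1..n}"
  shows "fock_gauge (flip_gauge (k 1) (x 1)) (fock_spin_product [1..<Suc n] k x \<phi>) l
    = - fock_spin_product [1..<Suc n] k x (fock_gauge (flip_gauge (k 1) (x 1)) \<phi>) l"
proof -
  let ?g = "flip_gauge (k 1) (x 1)"
  have split: "[1..<Suc n] = 1 # [2..<Suc n]"
    using assms(1) by (simp add: upt_rec numeral_2_eq_2)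
  have "?g (x i) = mat 1" if "i \<in> set [2..<Suc n]" for i
    using that assms inj_onD[OF assms(2), of i 1] by (auto simp: flip_gauge_def)
  then have "fock_gauge ?g (fock_spin_product [2..<Suc n] k x \<phi>)
      = fock_spin_product [2..<Suc n] k x (fock_gauge ?g \<phi>)"
    by (intro ext fock_gauge_fock_spin_product)
  moreover have "fock_gauge ?g (fock_spin (k 1) (x 1) \<phi>') l = - 1 * fock_spin (k 1) (x 1) (fock_gauge ?g \<phi>') l"
    for \<phi>'
    by (rule fock_gauge_fock_spin) (simp_all add: flip_gauge_def flip_SU2 flip_pauli)
  ultimately show ?thesis
    unfolding split by (simp add: fock_spin_product_def)
qed

section \<open>Group structure of SU(2)\<close>

lemma SU2_right_inverse: "M \<in> SU2 \<Longrightarrow> M ** adj M = mat 1"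
  by (simp add: SU2_def)

lemma SU2_left_inverse: "M \<in> SU2 \<Longrightarrow> adj M ** M = mat 1"
  using SU2_right_inverse matrix_left_right_inverse by blast

lemma adj_adj: "adj (adj M) = M"
  by (simp add: adj_def vec_eq_iff)

lemma adj_mult: "adj (M ** N) = adj N ** adj M"
  by (simp add: adj_def matrix_matrix_mult_def vec_eq_iff mult.commute)

lemma SU2_adj:
  assumes "M \<in> SU2"
  shows "adj M \<in> SU2"
proof -
  have "det (adj M) = cnj (det M)"
    by (simp add: adj_def det_2)
  with assms SU2_left_inverse[OF assms] show ?thesis
    by (simp add: SU2_def adj_adj)
qed

lemma SU2_mult:
  assumes "M \<in> SU2" "N \<in> SU2"
  shows "M ** N \<in> SU2"
proof -
  have "M ** N ** adj (M ** N) = M ** (N ** adj N) ** adj M"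
    by (simp add: adj_mult matrix_mul_assoc)
  with assms show ?thesis
    by (simp add: SU2_def det_mul)
qed

text \<open>\<open>matrix_inv\<close> chooses some two-sided inverse: \<open>adj M\<close> shows
  that there is one, and inverses are unique.\<close>

lemma matrix_inv_SU2:
  assumes "M \<in> SU2"
  shows "matrix_inv M = adj M"
proof -
  have "M ** matrix_inv M = mat 1 \<and> matrix_inv M ** M = mat 1"
    unfolding matrix_inv_def
    by (rule someI[of _ "adj M"]) (simp add: assms SU2_left_inverse SU2_right_inverse)
  then have "matrix_inv M = matrix_inv M ** (M ** adj M)" "matrix_inv M ** M = mat 1"
    using assms by (simp_all add: SU2_right_inverse)
  then show ?thesis
    by (simp add: matrix_mul_assoc)
qed

section \<open>Gauge transformations of connections\<close>

text \<open>An affine change of parameter preserves local power series and nonzero velocity. The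
  case \<open>a > b\<close> is included and gives reversed edges.\<close>

lemma edge_part_edges:
  assumes e: "e \<in> edges \<A>" and ab: "a \<in> {0..1}" "b \<in> {0..1}" "a \<noteq> b"
  shows "edge_part a b e \<in> edges \<A>"
proof -
  have mem: "a + (b - a) * t \<in> {0..1}" if "t \<in> {0..1}" for t
  proof -
    have "a + (b - a) * t = (1 - t) * a + t * b" by (simp add: algebra_simps)
    then show ?thesis
      using that ab convexD[OF convex_closed_interval[of 0 "1::real"], of a b "1 - t" t]
      by (simp add: cbox_interval)
  qed
  have "inj_on (edge_part a b e) {0..1}"
  proof (rule inj_onI)
    fix s t :: real
    assume st: "s \<in> {0..1}" "t \<in> {0..1}" and eq: "edge_part a b e s = edge_part a b e t"
    have "inj_on e {0..1}" using e by (simp add: edges_def)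
    then have "a + (b - a) * s = a + (b - a) * t"
      using eq mem[OF st(1)] mem[OF st(2)] unfolding edge_part_def by (rule inj_onD)
    with ab show "s = t" by simp
  qed
  moreover have "\<exists>(U, \<phi>)\<in>\<A>. \<exists>(c :: nat \<Rightarrow> real^3) r. r > 0 \<and> c 1 \<noteq> 0 \<and>
      (\<forall>s\<in>{0..1}. \<bar>s - t\<bar> < r \<longrightarrow> edge_part a b e s \<in> U \<and>
        (\<lambda>k. (s - t) ^ k *\<^sub>R c k) sums \<phi> (edge_part a b e s))" if t: "t \<in> {0..1}" for t
  proof -
    let ?t = "a + (b - a) * t"
    obtain U \<phi> and c :: "nat \<Rightarrow> real^3" and r where U: "(U, \<phi>) \<in> \<A>" "r > 0" "c 1 \<noteq> 0"
      and c: "\<And>s. s \<in> {0..1} \<Longrightarrow> \<bar>s - ?t\<bar> < r \<Longrightarrow> e s \<in> U \<and> (\<lambda>k. (s - ?t) ^ k *\<^sub>R c k) sums \<phi> (e s)"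
      using e mem[OF t] unfolding edges_def by fast
    \<comment> \<open>Since the parameter is stretched by \<open>b - a\<close>, the coefficients are
      rescaled by its powers and the radius is divided by its absolute value.\<close>
    let ?c = "\<lambda>k. (b - a) ^ k *\<^sub>R c k"
    have "edge_part a b e s \<in> U \<and> (\<lambda>k. (s - t) ^ k *\<^sub>R ?c k) sums \<phi> (edge_part a b e s)"
      if s: "s \<in> {0..1}" "\<bar>s - t\<bar> < r / \<bar>b - a\<bar>" for s
    proof -
      have diff: "a + (b - a) * s - ?t = (s - t) * (b - a)" by (simp add: algebra_simps)
      have "\<bar>a + (b - a) * s - ?t\<bar> < r"
        using s ab unfolding diff by (simp add: abs_mult pos_less_divide_eq)
      from c[OF mem[OF s(1)] this] show ?thesis
        unfolding diff by (simp add: edge_part_def power_mult_distrib)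
    qed
    moreover have "r / \<bar>b - a\<bar> > 0" "?c 1 \<noteq> 0"
      using U ab by simp_all
    ultimately show ?thesis
      using U(1) by (intro bexI[of _ "(U, \<phi>)"]) (auto intro!: exI[of _ ?c] exI[of _ "r / \<bar>b - a\<bar>"])
  qed
  ultimately show ?thesis by (simp add: edges_def)
qed

lemma reversepath_edges: "e \<in> edges \<A> \<Longrightarrow> reversepath e \<in> edges \<A>"
  using edge_part_edges[of e \<A> 1 0] by (simp add: edge_part_def reversepath_def)

text \<open>The expansion is known only on \<open>H\<close>, which is one-sided at an end point of
  an edge. One nonzero point of \<open>H\<close> already makes the series converge in a full
  neighbourhood of \<open>0\<close>, where its sum is continuous.\<close>

lemma power_series_tendsto_0:
  fixes a :: "nat \<Rightarrow> real"
  assumes sums: "\<And>h. h \<in> H \<Longrightarrow> (\<lambda>k. a k * h ^ k) sums f h" and H: "0 \<in> H"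
  shows "(f \<longlongrightarrow> f 0) (at 0 within H)"
proof (cases "H \<subseteq> {0}")
  case True
  with H have "H = {0}" by blast
  then show ?thesis by (simp add: at_within_def)
next
  case False
  then obtain h where h: "h \<in> H" "h \<noteq> 0" by blast
  have "summable (\<lambda>k. a k * h ^ k)"
    using sums[OF h(1)] by (rule sums_summable)
  then have "isCont (\<lambda>h. \<Sum>k. a k * h ^ k) 0"
    by (rule isCont_powser) (use h in simp)
  then have "((\<lambda>h. \<Sum>k. a k * h ^ k) \<longlongrightarrow> (\<Sum>k. a k * 0 ^ k)) (at 0 within H)"
    by (simp add: isCont_def tendsto_within_subset[OF _ subset_UNIV])
  moreover have "f h = (\<Sum>k. a k * h ^ k)" if "h \<in> H" for h
    using sums[OF that] by (rule sums_unique)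
  ultimately show ?thesis
    using H by (auto elim!: Lim_transform_eventually simp: eventually_at_filter)
qed

text \<open>In a chart the coordinates of the edge are power series about \<open>t\<close>, hence
  continuous at \<open>t\<close>; the inverse of the chart carries this back to the
  manifold.\<close>

lemma edges_continuous:
  assumes atlas: "analytic_atlas \<A>" and e: "e \<in> edges \<A>"
  shows "continuous_on {0..1} e"
  unfolding continuous_on_def
proof
  fix t :: real
  assume t: "t \<in> {0..1}"
  obtain U \<phi> and c :: "nat \<Rightarrow> real^3" and r where U: "(U, \<phi>) \<in> \<A>" "r > 0"
    and c: "\<And>s. s \<in> {0..1} \<Longrightarrow> \<bar>s - t\<bar> < r \<Longrightarrow> e s \<in> U \<and> (\<lambda>k. (s - t) ^ k *\<^sub>R c k) sums \<phi> (e s)"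
    using e t unfolding edges_def by fast
  have \<phi>: "open (\<phi> ` U)" "homeomorphism U (\<phi> ` U) \<phi> (inv_into U \<phi>)"
    using atlas U(1) unfolding analytic_atlas_def by auto
  let ?H = "{h. t + h \<in> {0..1} \<and> \<bar>h\<bar> < r}"
  have ev: "eventually (\<lambda>s. s \<in> {0..1} \<and> \<bar>s - t\<bar> < r) (at t within {0..1})"
    using U(2) by (auto simp: eventually_at dist_real_def intro!: exI[of _ r])
  have "((\<lambda>s. \<phi> (e s) $ i) \<longlongrightarrow> \<phi> (e t) $ i) (at t within {0..1})" for i
  proof -
    have "(\<lambda>k. c k $ i * h ^ k) sums \<phi> (e (t + h)) $ i" if "h \<in> ?H" for h
    proof -
      have "(\<lambda>k. h ^ k *\<^sub>R c k) sums \<phi> (e (t + h))" using c[of "t + h"] that by simp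
      from sums_vec_nth[OF this, of i] show ?thesis by (simp add: mult.commute)
    qed
    from power_series_tendsto_0[of ?H, OF this]
    have "((\<lambda>h. \<phi> (e (t + h)) $ i) \<longlongrightarrow> \<phi> (e t) $ i) (at 0 within ?H)"
      using U(2) t by simp
    moreover have "filterlim (\<lambda>s. s - t) (at 0 within ?H) (at t within {0..1})"
      unfolding filterlim_at
    proof
      show "\<forall>\<^sub>F s in at t within {0..1}. s - t \<in> ?H \<and> s - t \<noteq> 0"
        using ev by (auto simp: eventually_at_filter elim!: eventually_mono)
      have "((\<lambda>s. s - t) \<longlongrightarrow> t - t) (at t within {0..1})" by (intro tendsto_intros)
      then show "((\<lambda>s. s - t) \<longlongrightarrow> 0) (at t within {0..1})" by simp
    qed
    ultimately have "((\<lambda>s. \<phi> (e (t + (s - t))) $ i) \<longlongrightarrow> \<phi> (e t) $ i) (at t within {0..1})"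
      by (rule filterlim_compose)
    then show ?thesis by simp
  qed
  then have lim: "((\<lambda>s. \<phi> (e s)) \<longlongrightarrow> \<phi> (e t)) (at t within {0..1})"
    by (rule vec_tendstoI)
  have et: "e t \<in> U" using c[OF t] U(2) by simp
  have inv: "inv_into U \<phi> (\<phi> y) = y" if "y \<in> U" for y
    using \<phi>(2) that by (simp add: homeomorphism_def)
  have "continuous_on (\<phi> ` U) (inv_into U \<phi>)"
    using \<phi>(2) by (simp add: homeomorphism_def)
  \<comment> \<open>Openness of the chart image turns continuity on that image into continuity at a
    point of the whole space.\<close>
  then have "isCont (inv_into U \<phi>) (\<phi> (e t))"
    using \<phi>(1) et by (simp add: continuous_on_eq_continuous_at)
  from isCont_tendsto_compose[OF this lim]
  have "((\<lambda>s. inv_into U \<phi> (\<phi> (e s))) \<longlongrightarrow> e t) (at t within {0..1})"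
    by (simp add: inv et)
  then show "(e \<longlongrightarrow> e t) (at t within {0..1})"
  proof (rule Lim_transform_eventually)
    show "\<forall>\<^sub>F s in at t within {0..1}. inv_into U \<phi> (\<phi> (e s)) = e s"
      using ev by eventually_elim (use c inv in blast)
  qed
qed

text \<open>Connections identify edges with the same image and start, while the gauge action also
  involves the target, which therefore has to be determined by these data. The change of parameter
  \<open>f\<close> is a continuous injection of the unit interval into itself that fixes
  \<open>0\<close>; it must then fix \<open>1\<close>.\<close>

lemma pathfinish_unique:
  fixes e e' :: "real \<Rightarrow> 'a::t2_space"
  assumes e: "continuous_on {0..1} e" "inj_on e {0..1}"
    and e': "continuous_on {0..1} e'" "inj_on e' {0..1}"
    and image: "path_image e = path_image e'" and start: "pathstart e = pathstart e'"
  shows "pathfinish e = pathfinish e'"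
proof -
  define f where "f = inv_into {0..1} e' \<circ> e"
  have e'f: "e' (f t) = e t" and f_mem: "f t \<in> {0..1}" if "t \<in> {0..1}" for t
  proof -
    have "e t \<in> e' ` {0..1}" using that image by (auto simp: path_image_def)
    then show "e' (f t) = e t" "f t \<in> {0..1}"
      by (simp_all add: f_def f_inv_into_f inv_into_into del: atLeastAtMost_iff)
  qed
  have inj: "s = t" if "s \<in> {0..1}" "t \<in> {0..1}" "f s = f t" for s t
  proof -
    have "e s = e t" using that e'f by metis
    then show ?thesis using that e(2) by (simp add: inj_on_def)
  qed
  have "continuous_on (e' ` {0..1}) (inv_into {0..1} e')"
    using e' by (intro continuous_on_inv) (simp_all add: inv_into_f_f)
  then have cont: "continuous_on {0..1} f"
    unfolding f_def using e(1) image by (intro continuous_on_compose) (simp_all add: path_image_def)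
  have f0: "f 0 = 0"
    using start e'(2) e'f[of 0] f_mem[of 0] by (simp add: pathstart_def inj_on_def)
  have "f 1 = 1"
  proof (rule ccontr)
    assume "f 1 \<noteq> 1"
    have "e' 1 \<in> e ` {0..1}" using image by (auto simp: path_image_def)
    then obtain s where s: "s \<in> {0..1}" "e' 1 = e s" by blast
    then have fs: "f s = 1" using e'(2) e'f[of s] f_mem[of s] by (simp add: inj_on_def)
    \<comment> \<open>The value \<open>f 1\<close> lies between \<open>f 0 = 0\<close> and
      \<open>f s = 1\<close>, so it is attained on the interval from \<open>0\<close> to
      \<open>s\<close>. Injectivity places that point at \<open>1\<close>, which forces
      \<open>s = 1\<close>.\<close>
    have "\<exists>u. 0 \<le> u \<and> u \<le> s \<and> f u = f 1"
      using s f_mem[of 1] by (intro IVT') (auto simp: f0 fs intro: continuous_on_subset[OF cont])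
    then obtain u where "0 \<le> u" "u \<le> s" "f u = f 1" by blast
    with s inj[of u 1] have "s = 1" by simp
    with fs \<open>f 1 \<noteq> 1\<close> show False by simp
  qed
  with e'f[of 1] show ?thesis by (simp add: pathfinish_def)
qed

lemma connection_gauge_connections:
  assumes atlas: "analytic_atlas \<A>" and g: "gauge_transformation g" and A: "A \<in> connections \<A>"
  shows "connection_gauge \<A> g A \<in> connections \<A>"
proof -
  have gS: "g y \<in> SU2" for y using g by (simp add: gauge_transformation_def)
  have AS: "A e \<in> SU2" if "e \<in> edges \<A>" for e
    using A that unfolding connections_def by blast
  have gauge: "connection_gauge \<A> g A e = g (pathfinish e) ** A e ** adj (g (pathstart e))"
    if "e \<in> edges \<A>" for e
    using that by (simp add: connection_gauge_def matrix_inv_SU2 gS)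
  have "connection_gauge \<A> g A \<in> edges \<A> \<rightarrow>\<^sub>E SU2"
    by (auto simp: connection_gauge_def matrix_inv_SU2 gS AS SU2_mult SU2_adj)
  moreover have "connection_gauge \<A> g A e = connection_gauge \<A> g A e'"
    if e: "e \<in> edges \<A>" "e' \<in> edges \<A>" and eq: "path_image e = path_image e'" "pathstart e = pathstart e'"
    for e e'
  proof -
    have "pathfinish e = pathfinish e'"
      using e eq by (intro pathfinish_unique edges_continuous[OF atlas]) (auto simp: edges_def)
    moreover have "A e = A e'" using A e eq unfolding connections_def by blast
    ultimately show ?thesis using e eq by (simp add: gauge)
  qed
  moreover have "connection_gauge \<A> g A (reversepath e) = matrix_inv (connection_gauge \<A> g A e)"
    if e: "e \<in> edges \<A>" for e
  proof -
    have "A (reversepath e) = matrix_inv (A e)"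
      using A e unfolding connections_def by blast
    also have "\<dots> = adj (A e)" using e by (intro matrix_inv_SU2 AS)
    finally have "connection_gauge \<A> g A (reversepath e) = adj (connection_gauge \<A> g A e)"
      by (simp add: gauge[OF e] gauge[OF reversepath_edges[OF e]] adj_mult adj_adj matrix_mul_assoc)
    moreover have "connection_gauge \<A> g A e \<in> SU2"
      by (simp add: gauge[OF e] SU2_mult SU2_adj gS AS[OF e])
    ultimately show ?thesis by (simp add: matrix_inv_SU2)
  qed
  moreover have "connection_gauge \<A> g A e
      = connection_gauge \<A> g A (edge_part c 1 e) ** connection_gauge \<A> g A (edge_part 0 c e)"
    if e: "e \<in> edges \<A>" and c: "c \<in> {0<..<1}" for e c
  proof -
    have parts: "edge_part c 1 e \<in> edges \<A>" "edge_part 0 c e \<in> edges \<A>"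
      using e c by (auto intro: edge_part_edges)
    have ends: "pathfinish (edge_part c 1 e) = pathfinish e" "pathstart (edge_part c 1 e) = e c"
      "pathfinish (edge_part 0 c e) = e c" "pathstart (edge_part 0 c e) = pathstart e"
      by (simp_all add: edge_part_def pathfinish_def pathstart_def)
    \<comment> \<open>The target of the first piece is the source of the second, so the two gauge
      factors at \<open>e c\<close> cancel.\<close>
    have "connection_gauge \<A> g A (edge_part c 1 e) ** connection_gauge \<A> g A (edge_part 0 c e)
        = g (pathfinish e) ** A (edge_part c 1 e) ** (adj (g (e c)) ** g (e c)) ** A (edge_part 0 c e)
            ** adj (g (pathstart e))"
      by (simp add: gauge parts ends matrix_mul_assoc)
    also have "\<dots> = g (pathfinish e) ** (A (edge_part c 1 e) ** A (edge_part 0 c e)) ** adj (g (pathstart e))"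
      by (simp add: SU2_left_inverse gS matrix_mul_assoc)
    also have "A (edge_part c 1 e) ** A (edge_part 0 c e) = A e"
    proof (rule sym)
      show "A e = A (edge_part c 1 e) ** A (edge_part 0 c e)"
        using A e c unfolding connections_def by blast
    qed
    finally show ?thesis using e by (simp add: gauge)
  qed
  ultimately show ?thesis
    unfolding connections_def by blast
qed

section \<open>Invariance of the measures\<close>

lemma measurable_mult_SU2:
  assumes "f \<in> measurable M SU2_borel" "h \<in> measurable M SU2_borel"
  shows "(\<lambda>x. f x ** h x) \<in> measurable M SU2_borel"
proof (rule measurable_restrict_space2)
  show "(\<lambda>x. f x ** h x) \<in> space M \<rightarrow> SU2"
    using measurable_space[OF assms(1)] measurable_space[OF assms(2)]
    by (auto simp: space_restrict_space SU2_mult)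
  have "continuous_on UNIV (\<lambda>p :: (complex^2^2) \<times> (complex^2^2). fst p ** snd p)"
    unfolding matrix_matrix_mult_def by (intro continuous_intros)
  moreover have "f \<in> borel_measurable M" "h \<in> borel_measurable M"
    using assms by (simp_all add: measurable_restrict_space2_iff)
  ultimately show "(\<lambda>x. f x ** h x) \<in> borel_measurable M"
    by (rule borel_measurable_continuous_Pair[rotated -1])
qed

lemma measurable_adj_SU2: "adj \<in> measurable SU2_borel SU2_borel"
proof (rule measurable_restrict_space2)
  show "adj \<in> space SU2_borel \<rightarrow> SU2"
    by (simp add: space_restrict_space SU2_adj)
  have "continuous_on UNIV adj"
    unfolding adj_def by (intro continuous_intros)
  then show "adj \<in> borel_measurable SU2_borel"
    by (intro measurable_restrict_space1 borel_measurable_continuous_onI)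
qed

lemma measurable_translation_SU2:
  assumes "a \<in> SU2" "b \<in> SU2"
  shows "(\<lambda>u. a ** u ** b) \<in> measurable SU2_borel SU2_borel"
proof -
  have "(\<lambda>_. c) \<in> measurable SU2_borel SU2_borel" if "c \<in> SU2" for c
    using that by (intro measurable_const) (simp add: space_restrict_space)
  then show ?thesis
    using assms by (intro measurable_mult_SU2 measurable_ident) simp_all
qed

text \<open>The indicator of \<open>B\<close> at \<open>u ** v\<close> is integrated in both orders.
  Left invariance of \<open>\<nu>\<close> gives the value \<open>emeasure \<nu> B\<close>, right
  invariance of \<open>\<rho>\<close> gives \<open>emeasure \<rho> B\<close>, and both total masses
  are \<open>1\<close>.\<close>

lemma left_right_invariant_unique:
  assumes \<nu>: "prob_space \<nu>" "sets \<nu> = sets SU2_borel"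
    and \<rho>: "prob_space \<rho>" "sets \<rho> = sets SU2_borel"
    and left: "\<And>h. h \<in> SU2 \<Longrightarrow> distr \<nu> \<nu> (\<lambda>u. h ** u) = \<nu>"
    and right: "\<And>h. h \<in> SU2 \<Longrightarrow> distr \<rho> \<rho> (\<lambda>u. u ** h) = \<rho>"
  shows "\<nu> = \<rho>"
proof (rule measure_eqI)
  show "sets \<nu> = sets \<rho>" using \<nu> \<rho> by simp
  interpret \<nu>: prob_space \<nu> by fact
  interpret \<rho>: prob_space \<rho> by fact
  interpret pair_sigma_finite \<nu> \<rho> ..
  have space: "space \<nu> = SU2" "space \<rho> = SU2"
    using \<nu>(2) \<rho>(2) by (auto dest!: sets_eq_imp_space_eq simp: space_restrict_space)
  fix B assume "B \<in> sets \<nu>"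
  then have B: "B \<in> sets SU2_borel" using \<nu> by simp
  have mult: "(\<lambda>x. f x ** h x) \<in> measurable M N"
    if "f \<in> measurable M SU2_borel" "h \<in> measurable M SU2_borel" "sets N = sets SU2_borel"
    for f h and M :: "'z measure" and N
    using measurable_mult_SU2[OF that(1,2)] measurable_cong_sets[OF refl that(3)] by blast
  have id: "(\<lambda>u. u) \<in> measurable M SU2_borel" if "sets M = sets SU2_borel" for M
    using that by (simp add: measurable_ident_sets)
  have "emeasure \<nu> B = (\<integral>\<^sup>+ v. indicator B (u ** v) \<partial>\<nu>)" if u: "u \<in> SU2" for u
  proof -
    have m: "(\<lambda>v. u ** v) \<in> measurable \<nu> \<nu>"
      using u \<nu> by (intro mult id measurable_const) (auto simp: space_restrict_space)
    have "emeasure \<nu> B = (\<integral>\<^sup>+ v. indicator B v \<partial>(distr \<nu> \<nu> (\<lambda>v. u ** v)))"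
      using B \<nu>(2) by (simp add: left[OF u])
    also have "\<dots> = (\<integral>\<^sup>+ v. indicator B (u ** v) \<partial>\<nu>)"
      using B \<nu>(2) by (intro nn_integral_distr[OF m]) simp
    finally show ?thesis .
  qed
  then have "(\<integral>\<^sup>+ u. emeasure \<nu> B \<partial>\<rho>) = (\<integral>\<^sup>+ u. (\<integral>\<^sup>+ v. indicator B (u ** v) \<partial>\<nu>) \<partial>\<rho>)"
    by (intro nn_integral_cong) (simp only: space)
  then have "emeasure \<nu> B = (\<integral>\<^sup>+ u. (\<integral>\<^sup>+ v. indicator B (u ** v) \<partial>\<nu>) \<partial>\<rho>)"
    using \<rho>.emeasure_space_1 by simp
  also have "\<dots> = (\<integral>\<^sup>+ v. (\<integral>\<^sup>+ u. indicator B (u ** v) \<partial>\<rho>) \<partial>\<nu>)"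
  proof (rule Fubini')
    have "(\<lambda>p. snd p ** fst p) \<in> measurable (\<nu> \<Otimes>\<^sub>M \<rho>) SU2_borel"
      using \<nu>(2) \<rho>(2)
      by (intro measurable_mult_SU2 measurable_compose[OF measurable_snd id] measurable_compose[OF measurable_fst id])
    from measurable_compose[OF this, of "indicator B :: _ \<Rightarrow> ennreal" borel]
    show "(\<lambda>(v, u). indicator B (u ** v) :: ennreal) \<in> borel_measurable (\<nu> \<Otimes>\<^sub>M \<rho>)"
      using B by (simp add: case_prod_unfold)
  qed
  also have "\<dots> = (\<integral>\<^sup>+ v. emeasure \<rho> B \<partial>\<nu>)"
  proof (rule nn_integral_cong)
    fix v assume "v \<in> space \<nu>"
    then have v: "v \<in> SU2" by (simp add: space)
    have m: "(\<lambda>u. u ** v) \<in> measurable \<rho> \<rho>"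
      using v \<rho> by (intro mult id measurable_const) (auto simp: space_restrict_space)
    have "(\<integral>\<^sup>+ u. indicator B (u ** v) \<partial>\<rho>) = (\<integral>\<^sup>+ u. indicator B u \<partial>(distr \<rho> \<rho> (\<lambda>u. u ** v)))"
      using B \<rho>(2) by (intro nn_integral_distr[OF m, symmetric]) simp
    also have "\<dots> = emeasure \<rho> B"
      using B \<rho>(2) by (simp add: right[OF v])
    finally show "(\<integral>\<^sup>+ u. indicator B (u ** v) \<partial>\<rho>) = emeasure \<rho> B" .
  qed
  also have "\<dots> = emeasure \<rho> B"
    using \<nu>.emeasure_space_1 by simp
  finally show "emeasure \<nu> B = emeasure \<rho> B" .
qed

text \<open>The definition provides left invariance only. Inversion turns it into right invariance
  of the image measure \<open>\<rho>\<close>, and \<open>\<nu> = \<rho>\<close> by the preceding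
  lemma.\<close>

lemma haar_SU2_bi_invariant:
  assumes haar: "haar_SU2 \<nu>" and ab: "a \<in> SU2" "b \<in> SU2"
  shows "distr \<nu> \<nu> (\<lambda>u. a ** u ** b) = \<nu>"
proof -
  have \<nu>: "prob_space \<nu>" "sets \<nu> = sets SU2_borel"
    and left: "\<And>h. h \<in> SU2 \<Longrightarrow> distr \<nu> \<nu> (\<lambda>u. h ** u) = \<nu>"
    using haar by (auto simp: haar_SU2_def)
  have meas: "measurable \<nu> \<nu> = measurable SU2_borel SU2_borel"
    using \<nu>(2) by (intro measurable_cong_sets)
  have l: "(\<lambda>u. h ** u) \<in> measurable \<nu> \<nu>" and r: "(\<lambda>u. u ** h) \<in> measurable \<nu> \<nu>" if "h \<in> SU2" for h
    using measurable_translation_SU2[OF that mat_1_SU2] measurable_translation_SU2[OF mat_1_SU2 that]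
    by (simp_all add: meas)
  have adj: "adj \<in> measurable \<nu> \<nu>"
    using measurable_adj_SU2 by (simp add: meas)
  define \<rho> where "\<rho> = distr \<nu> \<nu> adj"
  have "distr \<rho> \<rho> (\<lambda>u. u ** h) = \<rho>" if h: "h \<in> SU2" for h
  proof -
    have "distr \<rho> \<rho> (\<lambda>u. u ** h) = distr \<rho> \<nu> (\<lambda>u. u ** h)"
      by (rule distr_cong) (simp_all add: \<rho>_def)
    also have "\<dots> = distr \<nu> \<nu> (\<lambda>u. adj u ** h)"
      unfolding \<rho>_def by (subst distr_distr[OF r[OF h] adj]) (simp add: comp_def)
    \<comment> \<open>Right translation after inversion is inversion after left translation by the
      inverse element.\<close>
    also have "\<dots> = distr \<nu> \<nu> (adj \<circ> (\<lambda>u. adj h ** u))"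
      by (simp add: comp_def adj_mult adj_adj)
    also have "\<dots> = distr (distr \<nu> \<nu> (\<lambda>u. adj h ** u)) \<nu> adj"
      by (rule distr_distr[symmetric, OF adj l[OF SU2_adj[OF h]]])
    also have "\<dots> = \<rho>"
      by (simp add: left[OF SU2_adj[OF h]] \<rho>_def)
    finally show ?thesis .
  qed
  moreover have "prob_space \<rho>" "sets \<rho> = sets SU2_borel"
    using prob_space.prob_space_distr[OF \<nu>(1) adj] \<nu>(2) by (simp_all add: \<rho>_def)
  ultimately have "\<nu> = \<rho>" "\<And>h. h \<in> SU2 \<Longrightarrow> distr \<rho> \<rho> (\<lambda>u. u ** h) = \<rho>"
    using left_right_invariant_unique[OF \<nu>] left by blast+
  then have right: "distr \<nu> \<nu> (\<lambda>u. u ** b) = \<nu>"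
    using ab by simp
  have "distr \<nu> \<nu> (\<lambda>u. a ** u ** b) = distr (distr \<nu> \<nu> (\<lambda>u. a ** u)) \<nu> (\<lambda>u. u ** b)"
    by (subst distr_distr[OF r[OF ab(2)] l[OF ab(1)]]) (simp add: comp_def)
  then show ?thesis
    using ab by (simp add: left right)
qed

text \<open>A finite product measure is determined by its values on boxes, and the preimage of a box
  under a componentwise map is again a box.\<close>

lemma distr_PiM_invariant:
  assumes \<nu>: "prob_space \<nu>" and I: "finite I"
    and f: "\<And>i. i \<in> I \<Longrightarrow> f i \<in> measurable \<nu> \<nu>"
    and inv: "\<And>i. i \<in> I \<Longrightarrow> distr \<nu> \<nu> (f i) = \<nu>"
  shows "distr (Pi\<^sub>M I (\<lambda>_. \<nu>)) (Pi\<^sub>M I (\<lambda>_. \<nu>)) (\<lambda>\<omega>. \<lambda>i\<in>I. f i (\<omega> i)) = Pi\<^sub>M I (\<lambda>_. \<nu>)"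
proof -
  interpret product_prob_space "\<lambda>_. \<nu>"
    by (rule product_prob_spaceI) (rule \<nu>)
  have T: "(\<lambda>\<omega>. \<lambda>i\<in>I. f i (\<omega> i)) \<in> measurable (Pi\<^sub>M I (\<lambda>_. \<nu>)) (Pi\<^sub>M I (\<lambda>_. \<nu>))"
    by (intro measurable_restrict measurable_compose[OF _ f] measurable_component_singleton)
  show ?thesis
  proof (rule PiM_eqI[OF I])
    show "sets (distr (Pi\<^sub>M I (\<lambda>_. \<nu>)) (Pi\<^sub>M I (\<lambda>_. \<nu>)) (\<lambda>\<omega>. \<lambda>i\<in>I. f i (\<omega> i)))
        = sets (Pi\<^sub>M I (\<lambda>_. \<nu>))"
      by simp
    fix B assume B: "\<And>i. i \<in> I \<Longrightarrow> B i \<in> sets \<nu>"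
    let ?C = "\<lambda>i. f i -` B i \<inter> space \<nu>"
    have "emeasure (distr (Pi\<^sub>M I (\<lambda>_. \<nu>)) (Pi\<^sub>M I (\<lambda>_. \<nu>)) (\<lambda>\<omega>. \<lambda>i\<in>I. f i (\<omega> i))) (Pi\<^sub>E I B)
        = emeasure (Pi\<^sub>M I (\<lambda>_. \<nu>)) ((\<lambda>\<omega>. \<lambda>i\<in>I. f i (\<omega> i)) -` Pi\<^sub>E I B \<inter> space (Pi\<^sub>M I (\<lambda>_. \<nu>)))"
      by (intro emeasure_distr T sets_PiM_I_finite I B)
    also have "(\<lambda>\<omega>. \<lambda>i\<in>I. f i (\<omega> i)) -` Pi\<^sub>E I B \<inter> space (Pi\<^sub>M I (\<lambda>_. \<nu>)) = Pi\<^sub>E I ?C"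
      by (auto simp: space_PiM PiE_iff)
    also have "emeasure (Pi\<^sub>M I (\<lambda>_. \<nu>)) \<dots> = (\<Prod>i\<in>I. emeasure \<nu> (?C i))"
      by (intro emeasure_PiM I measurable_sets[OF f] B)
    also have "\<dots> = (\<Prod>i\<in>I. emeasure \<nu> (B i))"
    proof (rule prod.cong)
      fix i assume i: "i \<in> I"
      show "emeasure \<nu> (?C i) = emeasure \<nu> (B i)"
        using emeasure_distr[OF f[OF i] B[OF i]] inv[OF i] by simp
    qed simp
    finally show "emeasure (distr (Pi\<^sub>M I (\<lambda>_. \<nu>)) (Pi\<^sub>M I (\<lambda>_. \<nu>)) (\<lambda>\<omega>. \<lambda>i\<in>I. f i (\<omega> i))) (Pi\<^sub>E I B)
        = (\<Prod>i\<in>I. emeasure \<nu> (B i))" .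
  qed
qed

section \<open>Gauge invariance of the Ashtekar-Lewandowski measure\<close>

lemma measurable_connection_gauge:
  assumes "analytic_atlas \<A>" "gauge_transformation g"
  shows "connection_gauge \<A> g \<in> measurable (connection_space \<A>) (connection_space \<A>)"
  unfolding connection_space_def
proof (rule measurable_restrict_space2)
  show "connection_gauge \<A> g
      \<in> space (restrict_space (Pi\<^sub>M (edges \<A>) (\<lambda>_. SU2_borel)) (connections \<A>)) \<rightarrow> connections \<A>"
    using connection_gauge_connections[OF assms] by (simp add: space_restrict_space)
  have "(\<lambda>u. g y ** u ** matrix_inv (g z)) \<in> measurable SU2_borel SU2_borel" for y z
    using assms(2)
    by (intro measurable_translation_SU2) (simp_all add: gauge_transformation_def matrix_inv_SU2 SU2_adj)
  then have "connection_gauge \<A> g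
      \<in> measurable (Pi\<^sub>M (edges \<A>) (\<lambda>_. SU2_borel)) (Pi\<^sub>M (edges \<A>) (\<lambda>_. SU2_borel))"
    unfolding connection_gauge_def
    by (intro measurable_restrict measurable_compose[OF measurable_component_singleton])
  then show "connection_gauge \<A> g
      \<in> measurable (restrict_space (Pi\<^sub>M (edges \<A>) (\<lambda>_. SU2_borel)) (connections \<A>))
          (Pi\<^sub>M (edges \<A>) (\<lambda>_. SU2_borel))"
    by (rule measurable_restrict_space1)
qed

lemma AL_measure_gauge_invariant:
  assumes atlas: "analytic_atlas \<A>" and haar: "haar_SU2 \<nu>" and AL: "AL_measure \<nu> \<A> \<mu>"
    and g: "gauge_transformation g"
  shows "connection_gauge \<A> g \<in> measurable \<mu> \<mu>" "distr \<mu> \<mu> (connection_gauge \<A> g) = \<mu>"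
proof -
  let ?G = "connection_gauge \<A> g"
  have sets: "sets \<mu> = sets (connection_space \<A>)"
    and graph: "\<And>\<gamma>. \<gamma> \<in> graphs \<A> \<Longrightarrow>
      distr \<mu> (Pi\<^sub>M \<gamma> (\<lambda>_. \<nu>)) (\<lambda>A. restrict A \<gamma>) = Pi\<^sub>M \<gamma> (\<lambda>_. \<nu>)"
    using AL by (auto simp: AL_measure_def graphwise_haar_def)
  have \<nu>: "prob_space \<nu>" "sets \<nu> = sets SU2_borel"
    using haar by (auto simp: haar_SU2_def)
  have gS: "g y \<in> SU2" for y using g by (simp add: gauge_transformation_def)
  show G: "?G \<in> measurable \<mu> \<mu>"
    using measurable_connection_gauge[OF atlas g] measurable_cong_sets[OF sets sets] by blast
  have "distr (distr \<mu> \<mu> ?G) (Pi\<^sub>M \<gamma> (\<lambda>_. \<nu>)) (\<lambda>A. restrict A \<gamma>) = Pi\<^sub>M \<gamma> (\<lambda>_. \<nu>)"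
    if \<gamma>: "\<gamma> \<in> graphs \<A>" for \<gamma>
  proof -
    let ?P = "Pi\<^sub>M \<gamma> (\<lambda>_. \<nu>)"
    let ?f = "\<lambda>e u. g (pathfinish e) ** u ** adj (g (pathstart e))"
    have sub: "finite \<gamma>" "\<gamma> \<subseteq> edges \<A>" using \<gamma> by (auto simp: graphs_def)
    have R: "(\<lambda>A. restrict A \<gamma>) \<in> measurable \<mu> ?P"
    proof -
      have "(\<lambda>A. restrict A \<gamma>) \<in> measurable (connection_space \<A>) ?P"
        unfolding connection_space_def using sub(2) \<nu>(2)
        by (intro measurable_restrict_space1 measurable_restrict_subset') auto
      then show ?thesis using measurable_cong_sets[OF sets refl] by blast
    qed
    have f: "?f e \<in> measurable \<nu> \<nu>" for e
      using measurable_translation_SU2 measurable_cong_sets[OF \<nu>(2) \<nu>(2)] gS SU2_adj by blast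
    have T: "(\<lambda>\<omega>. \<lambda>e\<in>\<gamma>. ?f e (\<omega> e)) \<in> measurable ?P ?P"
      by (intro measurable_restrict measurable_compose[OF _ f] measurable_component_singleton)
    have "distr (distr \<mu> \<mu> ?G) ?P (\<lambda>A. restrict A \<gamma>) = distr \<mu> ?P ((\<lambda>A. restrict A \<gamma>) \<circ> ?G)"
      by (rule distr_distr[OF R G])
    \<comment> \<open>The new holonomy of an edge depends on its old holonomy alone, so the
      transformation descends to the edges of the graph, where it is a two-sided translation in each
      factor.\<close>
    also have "(\<lambda>A. restrict A \<gamma>) \<circ> ?G = (\<lambda>\<omega>. \<lambda>e\<in>\<gamma>. ?f e (\<omega> e)) \<circ> (\<lambda>A. restrict A \<gamma>)"
      using sub(2) by (auto simp: fun_eq_iff connection_gauge_def restrict_def matrix_inv_SU2 gS)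
    also have "distr \<mu> ?P \<dots> = distr (distr \<mu> ?P (\<lambda>A. restrict A \<gamma>)) ?P (\<lambda>\<omega>. \<lambda>e\<in>\<gamma>. ?f e (\<omega> e))"
      by (rule distr_distr[OF T R, symmetric])
    also have "\<dots> = ?P"
      unfolding graph[OF \<gamma>]
      by (intro distr_PiM_invariant \<nu>(1) sub(1) f haar_SU2_bi_invariant[OF haar] gS SU2_adj)
    finally show ?thesis .
  qed
  then have "graphwise_haar \<nu> \<A> (distr \<mu> \<mu> ?G)"
    using sets by (simp add: graphwise_haar_def)
  then show "distr \<mu> \<mu> ?G = \<mu>"
    using AL unfolding AL_measure_def by blast
qed

section \<open>Correlations\<close>

lemma integrable_L2_product:
  assumes "\<psi> \<in> L2 \<mu>" "\<psi>' \<in> L2 \<mu>"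
  shows "integrable \<mu> (\<lambda>A. cnj (\<psi> A) * \<psi>' A)"
proof (rule Bochner_Integration.integrable_bound)
  have meas: "\<psi> \<in> borel_measurable \<mu>" "\<psi>' \<in> borel_measurable \<mu>"
    using assms by (simp_all add: L2_def)
  have "continuous_on UNIV cnj"
    by (rule continuous_on_cnj) (rule continuous_on_id)
  then have "cnj \<in> borel_measurable borel"
    by (rule borel_measurable_continuous_onI)
  with meas(1) have "(\<lambda>A. cnj (\<psi> A)) \<in> borel_measurable \<mu>"
    by (rule measurable_compose)
  then show "(\<lambda>A. cnj (\<psi> A) * \<psi>' A) \<in> borel_measurable \<mu>"
    using meas(2) by (rule borel_measurable_times)
  show "integrable \<mu> (\<lambda>A. (norm (\<psi> A))\<^sup>2 + (norm (\<psi>' A))\<^sup>2)"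
    using assms by (simp add: L2_def)
  have "a * b \<le> a\<^sup>2 + b\<^sup>2" if "a \<ge> 0" "b \<ge> 0" for a b :: real
    using sum_squares_bound[of a b] mult_nonneg_nonneg[OF that] by linarith
  then show "AE A in \<mu>. norm (cnj (\<psi> A) * \<psi>' A) \<le> norm ((norm (\<psi> A))\<^sup>2 + (norm (\<psi>' A))\<^sup>2)"
    by (simp add: norm_mult)
qed

text \<open>A family that is not summable has the sum \<open>0\<close> by convention.\<close>

lemma infsum_fibres_eq_0:
  fixes f :: "'a \<Rightarrow> 'b::banach"
  assumes fin: "\<And>y. finite {x. p x = y}" and zero: "\<And>y. (\<Sum>x | p x = y. f x) = 0"
  shows "infsum f UNIV = 0"
proof (cases "f summable_on UNIV")
  case True
  let ?S = "Sigma UNIV (\<lambda>y. {x. p x = y})"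
  \<comment> \<open>Each point is paired with the label of its fibre, so that the sum becomes an
    iterated one with finite inner sums.\<close>
  have bij: "bij_betw snd ?S UNIV"
    by (rule bij_betwI[where g = "\<lambda>x. (p x, x)"]) auto
  have "(\<lambda>(y, x). f x) summable_on ?S"
    using True summable_on_reindex_bij_betw[OF bij, of f] by (simp add: case_prod_unfold)
  from infsum_Sigma'_banach[OF this]
  have "(\<Sum>\<^sub>\<infinity>(y, x)\<in>?S. f x) = 0"
    by (simp add: fin zero)
  then show ?thesis
    using infsum_reindex_bij_betw[OF bij, of f] by (simp add: case_prod_unfold)
next
  case False
  then show ?thesis by (rule infsum_not_exists)
qed

theorem proposition2p1:
  fixes \<A> :: "('s::{t2_space,second_countable_topology}) chart set"
    and \<nu> :: "(complex^2^2) measure"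
    and \<mu> :: "'s connection measure"
    and \<Psi> :: "'s mode list \<Rightarrow> 's connection \<Rightarrow> complex"
    and n :: nat and x :: "nat \<Rightarrow> 's" and k :: "nat \<Rightarrow> 3"
  assumes "analytic_atlas \<A>"
    and "haar_SU2 \<nu>"
    and "AL_measure \<nu> \<A> \<mu>"
    and "n > 0"
    and "inj_on x {1..n}"
    and "\<Psi> \<in> total_space \<mu>"
    and "gauge_invariant \<A> \<mu> \<Psi>"
  shows "spin_correlation \<mu> \<Psi> n k x = 0"
proof -
  define S where "S = fock_spin_product [1..<Suc n] k x"
  define g where "g = flip_gauge (k 1) (x 1)"
  define G where "G = connection_gauge \<A> g"
  let ?\<Phi> = "spin_product n k x \<Psi>"
  have \<Phi>: "?\<Phi> l A = S (\<lambda>m. \<Psi> m A) l" for l A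
    by (simp add: spin_product_eq S_def)
  have g: "gauge_transformation g"
    by (simp add: g_def gauge_transformation_flip)
  have flip: "fock_gauge g (S \<phi>) l = - S (fock_gauge g \<phi>) l" for \<phi> l
    unfolding g_def S_def by (rule flip_gauge_fock_spin_product) fact+
  have G: "G \<in> measurable \<mu> \<mu>" "distr \<mu> \<mu> G = \<mu>"
    unfolding G_def using AL_measure_gauge_invariant[OF assms(1-3) g] .
  have L2: "\<Psi> l \<in> L2 \<mu>" for l
    using assms(6) by (simp add: total_space_def families_def)
  obtain F a where fin: "\<And>l. finite (F l)" and S: "\<And>\<phi> l. S \<phi> l = (\<Sum>m\<in>F l. a l m * \<phi> m)"
    using finite_rows_fock_spin_product unfolding S_def by (rule finite_rowsE) blast
  \<comment> \<open>This allows the integral to be exchanged with the finite sum over a block of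
    lists at the end.\<close>
  have integrable: "integrable \<mu> (\<lambda>A. cnj (\<Psi> l A) * ?\<Phi> l A)" for l
  proof -
    have "integrable \<mu> (\<lambda>A. \<Sum>m\<in>F l. a l m * (cnj (\<Psi> l A) * \<Psi> m A))"
      by (intro Bochner_Integration.integrable_sum integrable_mult_right integrable_L2_product L2)
    then show ?thesis
      by (simp add: \<Phi> S sum_distrib_left mult.left_commute)
  qed
  have invariant: "AE A in \<mu>. fock_gauge g (\<lambda>m. \<Psi> m (G A)) l = \<Psi> l A" for l
    using assms(7) g
    by (simp add: gauge_invariant_def total_eq_def total_gauge_def fock_lift_def AL_gauge_def G_def)
  have "(\<Sum>l | map fst l = ys. L2_inner \<mu> (\<Psi> l) (?\<Phi> l)) = 0" for ys
  proof -
    \<comment> \<open>\<open>H\<close> is the contribution of all lists over the sites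
      \<open>ys\<close> at one connection; its integral is the sum to be shown zero. A single list
      would not do, since the gauge transformation mixes the spin labels.\<close>
    define H where "H A = (\<Sum>l\<in>site_lists ys. cnj (\<Psi> l A) * ?\<Phi> l A)" for A
    have H: "H \<in> borel_measurable \<mu>"
      unfolding H_def using integrable by (intro borel_measurable_sum borel_measurable_integrable)
    have "AE A in \<mu>. \<forall>l\<in>site_lists ys. fock_gauge g (\<lambda>m. \<Psi> m (G A)) l = \<Psi> l A"
      using invariant by (simp add: AE_finite_all finite_site_lists)
    \<comment> \<open>Row \<open>l\<close> of \<open>S\<close> reads the entries in
      \<open>F l\<close>, whose sites need not be \<open>ys\<close>; invariance is required at these
      entries too.\<close>
    moreover have "AE A in \<mu>. \<forall>l\<in>site_lists ys. \<forall>m\<in>F l. fock_gauge g (\<lambda>m. \<Psi> m (G A)) m = \<Psi> m A"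
      using invariant fin by (simp add: AE_finite_all finite_site_lists)
    ultimately have flip_H: "AE A in \<mu>. H (G A) = - H A"
    proof eventually_elim
      case (elim A)
      let ?U = "fock_gauge g (\<lambda>m. \<Psi> m (G A))"
      \<comment> \<open>The isometry inserts \<open>fock_gauge g\<close> into both arguments. Moving
        it past \<open>S\<close> produces the sign, and invariance then brings the wave function
        back from \<open>G A\<close> to \<open>A\<close>.\<close>
      have "H (G A) = (\<Sum>l\<in>site_lists ys. cnj (?U l) * fock_gauge g (S (\<lambda>m. \<Psi> m (G A))) l)"
        by (simp add: H_def \<Phi> fock_gauge_isometry[OF g])
      also have "\<dots> = (\<Sum>l\<in>site_lists ys. - (cnj (\<Psi> l A) * ?\<Phi> l A))"
      proof (rule sum.cong)
        fix l assume l: "l \<in> site_lists ys"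
        then have "S ?U l = ?\<Phi> l A"
          using elim(2) by (simp add: \<Phi> S)
        with l elim(1) show "cnj (?U l) * fock_gauge g (S (\<lambda>m. \<Psi> m (G A))) l = - (cnj (\<Psi> l A) * ?\<Phi> l A)"
          by (simp add: flip)
      qed simp
      also have "\<dots> = - H A"
        by (simp add: H_def sum_negf)
      finally show ?case .
    qed
    have "integral\<^sup>L \<mu> H = integral\<^sup>L (distr \<mu> \<mu> G) H"
      by (simp add: G(2))
    also have "\<dots> = (LINT A|\<mu>. H (G A))"
      using G(1) H by (rule integral_distr)
    also have "\<dots> = (LINT A|\<mu>. - H A)"
      using flip_H measurable_compose[OF G(1) H] by (intro integral_cong_AE) (use H in simp_all)
    finally have "integral\<^sup>L \<mu> H = - integral\<^sup>L \<mu> H"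
      by simp
    then have "integral\<^sup>L \<mu> H = 0"
      by simp
    then show ?thesis
      unfolding H_def L2_inner_def site_lists_def[symmetric]
      by (simp add: integrable Bochner_Integration.integral_sum)
  qed
  \<comment> \<open>The lists are grouped by their sites; every group is finite and contributes
    zero.\<close>
  then have "(\<Sum>\<^sub>\<infinity>l. L2_inner \<mu> (\<Psi> l) (?\<Phi> l)) = 0"
    using finite_site_lists unfolding site_lists_def by (rule infsum_fibres_eq_0[rotated])
  then show ?thesis
    by (simp add: spin_correlation_def total_inner_def)
qed

end
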